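(* There is an absolute constant $C>0$ such that the following holds. Let $f:\mathbb R_+\to\mathbb C$ be locally absolutely continuous, of bounded variation, and such that $\lim_{t\to\infty}f(t)=0$. Then for the sine Fourier transform of $f$ one has, for every $x>0$, $$\widehat{f_s}(x)=\int_0^\infty f(t)\sin xt\,dt=\frac1x f\Big(\frac{\pi}{2x}\Big)+\mathcal H_0\mathcal T_{f'}(x)+G(x),$$ where the function $G$ satisfies $$\|G\|_{L^1(\mathbb R_+)}\le C\,\|f'\|_{L^1(\mathbb R_+)} .$$
   Context: Here $\mathbb R_+=[0,\infty)$. The integral defining $\widehat{f_s}(x)$ is understood as the improper integral $\lim_{A\to\infty}\int_0^A$. For an integrable function $g$ on $\mathbb R_+$, the sine Fourier transform is $\widehat{g_s}(x)=\int_0^\infty g(t)\sin xt\,dt$, and $$\mathcal T_g(x)=\frac{\widehat{g_s}(x)}{x},\qquad x>0.$$ For a function $h$ on $\mathbb R_+$, $$\mathcal H_0h(x)=\frac2\pi\int_0^\infty\frac{t\,h(t)}{t^2-x^2}\,dt,\qquad x>0,$$ where the integral is understood in the principal value sense, i.e. as $\lim_{\delta\to0+}\int_{t>0,\,|t-x|>\delta}$. (This is the Hilbert transform $\frac1\pi\int_{\mathbb R}\frac{h(t)}{t-x}\,dt$ of the odd extension of $h$.) Thus $\mathcal H_0\mathcal T_{f'}(x)=\frac2\pi\int_0^\infty\frac{\widehat{f'_s}(u)}{u^2-x^2}\,du$ in the principal value sense, where $\widehat{f'_s}$ is the sine Fourier transform of $f'$. *)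

theory Defs
  imports "HOL-Analysis.Analysis"
begin

text \<open>
  The pieces of a \<open>division_of\<close> on the real line are nonempty compact intervals with disjoint
  interiors, so for such a piece \<open>K = {a..b}\<close> the increment is \<open>f b - f a\<close>.
\<close>

definition increment :: "(real \<Rightarrow> 'a::real_normed_vector) \<Rightarrow> real set \<Rightarrow> 'a" where
  "increment f K = f (Sup K) - f (Inf K)"

definition abs_continuous_on :: "(real \<Rightarrow> 'a::real_normed_vector) \<Rightarrow> real set \<Rightarrow> bool" where
  "abs_continuous_on f S \<longleftrightarrow>
     (\<forall>\<epsilon>>0. \<exists>\<delta>>0. \<forall>D. D division_of \<Union>D \<and> \<Union>D \<subseteq> S \<and> (\<Sum>K\<in>D. measure lborel K) < \<delta> \<longrightarrow>
        (\<Sum>K\<in>D. norm (increment f K)) < \<epsilon>)"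

definition locally_abs_continuous_on :: "(real \<Rightarrow> 'a::real_normed_vector) \<Rightarrow> real set \<Rightarrow> bool" where
  "locally_abs_continuous_on f S \<longleftrightarrow> (\<forall>a b. {a..b} \<subseteq> S \<longrightarrow> abs_continuous_on f {a..b})"

definition bounded_variation_on :: "(real \<Rightarrow> 'a::real_normed_vector) \<Rightarrow> real set \<Rightarrow> bool" where
  "bounded_variation_on f S \<longleftrightarrow>
     (\<exists>B. \<forall>a b D. {a..b} \<subseteq> S \<and> D division_of {a..b} \<longrightarrow> (\<Sum>K\<in>D. norm (increment f K)) \<le> B)"

text \<open>
  The derivative of a locally absolutely continuous function exists only almost everywhere. On the
  remaining null set \<open>vector_derivative\<close> has an unspecified value, which affects no integral.
\<close>

abbreviation ae_deriv :: "(real \<Rightarrow> complex) \<Rightarrow> real \<Rightarrow> complex" where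
  "ae_deriv f \<equiv> (\<lambda>t. vector_derivative f (at t))"

definition L1_norm :: "(real \<Rightarrow> complex) \<Rightarrow> real" where
  "L1_norm g = (LINT t:{0..}|lebesgue. norm (g t))"

text \<open>
  The integrals below are limits of Lebesgue integrals; \<open>Lim\<close> is meaningful only if the limit
  exists, which the corresponding \<open>_exists\<close> predicate asserts. For integrable \<open>g\<close> the improper
  integral is the Lebesgue integral over the half-line.
\<close>

definition sine_integral_upto :: "(real \<Rightarrow> complex) \<Rightarrow> real \<Rightarrow> real \<Rightarrow> complex" where
  "sine_integral_upto g x A = (LINT t:{0..A}|lebesgue. g t * of_real (sin (x * t)))"

definition sine_transform :: "(real \<Rightarrow> complex) \<Rightarrow> real \<Rightarrow> complex" where
  "sine_transform g x = Lim at_top (sine_integral_upto g x)"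

definition sine_transform_exists :: "(real \<Rightarrow> complex) \<Rightarrow> real \<Rightarrow> bool" where
  "sine_transform_exists g x \<longleftrightarrow>
     (\<forall>A>0. (\<lambda>t. g t * of_real (sin (x * t))) absolutely_integrable_on {0..A}) \<and>
     (\<exists>l. (sine_integral_upto g x \<longlongrightarrow> l) at_top)"

definition T_op :: "(real \<Rightarrow> complex) \<Rightarrow> real \<Rightarrow> complex" where
  "T_op g x = sine_transform g x / of_real x"

definition H0_kernel :: "(real \<Rightarrow> complex) \<Rightarrow> real \<Rightarrow> real \<Rightarrow> complex" where
  "H0_kernel h x t = of_real t * h t / of_real (t\<^sup>2 - x\<^sup>2)"

definition H0_truncated :: "(real \<Rightarrow> complex) \<Rightarrow> real \<Rightarrow> real \<Rightarrow> complex" where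
  "H0_truncated h x \<delta> =
     of_real (2 / pi) * (LINT t:{t. 0 < t \<and> \<bar>t - x\<bar> > \<delta>}|lebesgue. H0_kernel h x t)"

definition H0 :: "(real \<Rightarrow> complex) \<Rightarrow> real \<Rightarrow> complex" where
  "H0 h x = Lim (at_right 0) (H0_truncated h x)"

definition H0_exists :: "(real \<Rightarrow> complex) \<Rightarrow> real \<Rightarrow> bool" where
  "H0_exists h x \<longleftrightarrow>
     (\<forall>\<delta>>0. H0_kernel h x absolutely_integrable_on {t. 0 < t \<and> \<bar>t - x\<bar> > \<delta>}) \<and>
     (\<exists>l. (H0_truncated h x \<longlongrightarrow> l) (at_right 0))"

end

theory Submission
  imports Defs "HOL-Probability.Sinc_Integral"
begin

text \<open>
  Write \<open>f(t) = - \<integral>\<^sub>t\<^sup>\<infinity> g\<close> with \<open>g = f' \<in> L\<^sup>1\<close>. Integration by parts gives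
  \<open>x \<integral> f(t) sin xt dt = \<integral> g(t) (cos xt - 1) dt\<close>, and by Fubini \<open>x H\<^sub>0 T\<^sub>g(x) = \<integral> g(t) k(xt) dt\<close>
  with \<open>k(s) = 2/\<pi> PV \<integral>\<^sub>0\<^sup>\<infinity> sin(us)/(u\<^sup>2 - 1) du\<close>. Since
  \<open>1/(u\<^sup>2 - 1) = 1/(u(u + 1)) + 1/(u(u\<^sup>2 - 1))\<close> and \<open>PV \<integral>\<^sub>0\<^sup>\<infinity> sin(us)/(u(u\<^sup>2 - 1)) du = \<pi>/2 (cos s - 1)\<close>,
  one has \<open>k(s) = cos s - 1 + 2/\<pi> J(s)\<close> with the absolutely convergent integral
  \<open>J(s) = \<integral>\<^sub>0\<^sup>\<infinity> sin(us)/(u(u + 1)) du\<close>. Hence \<open>x G(x) = \<integral> g(t) m(xt) dt\<close> where \<open>m(s)\<close> is the indicator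
  of \<open>s \<ge> \<pi>/2\<close> minus \<open>2/\<pi> J(s)\<close>. As \<open>J(s) = O(\<surd>s)\<close> and \<open>J(s) = \<pi>/2 + O(1/s)\<close>, the integral of
  \<open>\<bar>m(s)\<bar>/s\<close> is finite, and Tonelli's theorem yields the bound on \<open>G\<close>.

  That \<open>g\<close> exists follows from the Radon-Nikodym theorem, applied to the Stieltjes measures of the
  variation of \<open>f\<close> and of its sum with the real or imaginary part of \<open>f\<close>; that \<open>g\<close> is the derivative of
  \<open>f\<close> almost everywhere follows from Henstock's lemma and the Vitali covering theorem.
\<close>

subsection \<open>Lebesgue differentiation on the line\<close>

text \<open>The obstacle is the cosine: \<open>cos s - 1\<close> does not tend to 0 at infinity, so
  it is not absolutely integrable against \<open>ds / s\<close>, and no estimate by absolute values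
  could absorb it. The kernel is therefore split so that this term occurs identically in both
  transforms and cancels. What is left, \<open>2 / pi * rat_Si s\<close>, still tends to 1 at
  infinity; this limit is what the term \<open>f (pi / (2 * x)) / x\<close> removes, being
  \<open>- 1 / x\<close> times the integral of the density over \<open>x * t \<ge> pi / 2\<close>.
  The constant of the theorem is \<open>6 * pi\<close>: the weight
  \<open>1 / (sqrt s * (1 + s))\<close> has integral \<open>pi\<close> over the half-line, and
  \<open>6\<close> is the factor by which it dominates the remainder kernel divided by
  \<open>s\<close>.

  A separate difficulty is that the derivative exists only almost everywhere and says nothing by
  itself about increments. Hence the density is first produced by measure theory, all analysis is
  done with that Borel function, and the derivative is replaced by it off a negligible set.\<close>

lemma negligible_not_has_vector_derivative_integral:
  fixes g :: "real \<Rightarrow> 'a::euclidean_space"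
  assumes g: "g integrable_on {a..b}"
  shows "negligible {x\<in>{a..b}. \<not> ((\<lambda>u. integral {a..u} g) has_vector_derivative g x) (at x within {a..b})}"
proof -
  define F where "F u = integral {a..u} g" for u
  \<comment> \<open>Points at which the difference quotient misses \<open>g x\<close> by more than
    \<open>e\<close> at arbitrarily small scales. Vitali selects disjoint bad intervals that nearly
    cover them, and Henstock's lemma bounds the total length of such intervals.\<close>
  define E where "E e = {x\<in>{a..b}. \<forall>d>0. \<exists>y\<in>{a..b}. \<bar>y - x\<bar> < d \<and>
      norm (F y - F x - (y - x) *\<^sub>R g x) > e * \<bar>y - x\<bar>}" for e
  have F_diff: "integral {min x y..max x y} g = F (max x y) - F (min x y)"
    if "x \<in> {a..b}" "y \<in> {a..b}" for x y
  proof -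
    have "g integrable_on {a..max x y}"
      by (rule integrable_on_subinterval[OF g]) (use that in auto)
    from Henstock_Kurzweil_Integration.integral_combine[OF _ _ this, of "min x y"] that
    show ?thesis unfolding F_def by (auto simp: algebra_simps)
  qed
  have neg: "negligible (E e)" if "e > 0" for e
    unfolding negligible_outer_le
  proof (intro allI impI)
    fix \<epsilon> :: real assume "\<epsilon> > 0"
    with \<open>e > 0\<close> have "e * \<epsilon> > 0" by simp
    \<comment> \<open>The tolerance is \<open>e * \<epsilon>\<close> because a bad interval
      contributes at least \<open>e\<close> times its length to Henstock's sum.\<close>
    obtain \<gamma> where "gauge \<gamma>" and \<gamma>: "\<And>p. \<lbrakk>p tagged_partial_division_of (cbox a b); \<gamma> fine p\<rbrakk> \<Longrightarrow>
             (\<Sum>(x,k)\<in>p. norm (measure lborel k *\<^sub>R g x - integral k g)) < e * \<epsilon>"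
      by (rule Henstock_lemma[of g a b "e * \<epsilon>"]) (use g \<open>e * \<epsilon> > 0\<close> in \<open>auto simp: split_def\<close>)
    \<comment> \<open>A pair \<open>(x, y)\<close> stands for the interval between \<open>x\<close>
      and \<open>y\<close> with tag \<open>x\<close>, on either side of the tag. The ball with
      centre \<open>c\<close> and radius \<open>r\<close> is that same interval, in the form
      required by the Vitali theorem.\<close>
    define K where "K = {(x,y). x \<in> {a..b} \<and> y \<in> {a..b} \<and> x \<noteq> y \<and> {min x y..max x y} \<subseteq> \<gamma> x \<and>
        norm (F y - F x - (y - x) *\<^sub>R g x) > e * \<bar>y - x\<bar>}"
    define c where "c = (\<lambda>(x,y). (x + y) / 2 :: real)"
    define r where "r = (\<lambda>(x,y). \<bar>y - x\<bar> / 2 :: real)"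
    have cb: "cball (c i) (r i) = {min (fst i) (snd i)..max (fst i) (snd i)}" for i
      by (cases i) (simp add: c_def r_def cball_eq_atLeastAtMost min_def max_def field_simps)
    obtain C where C: "countable C" "C \<subseteq> K"
      "pairwise (\<lambda>i j. disjnt (cball (c i) (r i)) (cball (c j) (r j))) C"
      and negC: "negligible (E e - (\<Union>i\<in>C. cball (c i) (r i)))"
    proof (rule Vitali_covering_theorem_cballs[of K r "E e" c])
      show "0 < r i" if "i \<in> K" for i using that by (auto simp: K_def r_def)
    next
      fix x d assume x: "x \<in> E e" and "0 < (d::real)"
      have "open (\<gamma> x)" "x \<in> \<gamma> x" using \<open>gauge \<gamma>\<close> by (auto simp: gauge_def)
      then obtain s where s: "s > 0" "ball x s \<subseteq> \<gamma> x" by (meson openE)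
      with \<open>d > 0\<close> have "min d s > 0" by simp
      then obtain y where y: "y \<in> {a..b}" "\<bar>y - x\<bar> < min d s"
        "norm (F y - F x - (y - x) *\<^sub>R g x) > e * \<bar>y - x\<bar>"
        using x unfolding E_def by blast
      have "{min x y..max x y} \<subseteq> ball x s" using y(2) by (auto simp: dist_real_def)
      then have "(x, y) \<in> K" using x y s by (auto simp: K_def E_def)
      moreover have "x \<in> cball (c (x,y)) (r (x,y))" unfolding cb by simp
      moreover have "r (x,y) < d" using y by (auto simp: r_def)
      ultimately show "\<exists>i. i \<in> K \<and> x \<in> cball (c i) (r i) \<and> r i < d" by blast
    qed (use that in blast)
    have meas: "measure lebesgue (\<Union>i\<in>I. cball (c i) (r i)) \<le> \<epsilon>" if I: "I \<subseteq> C" "finite I" for I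
    proof -
      define p where "p = (\<lambda>i. (fst i, cball (c i) (r i))) ` I"
      \<comment> \<open>Distinct pairs have disjoint nonempty intervals, so a sum over tagged
        intervals is a sum over the index set.\<close>
      have inj: "inj_on (\<lambda>i. (fst i, cball (c i) (r i))) I"
      proof (rule inj_onI)
        fix i j assume ij: "i \<in> I" "j \<in> I" "(fst i, cball (c i) (r i)) = (fst j, cball (c j) (r j))"
        have "cball (c i) (r i) \<noteq> {}" unfolding cb by auto
        moreover have "cball (c i) (r i) = cball (c j) (r j)" using ij by simp
        moreover have "i \<noteq> j \<Longrightarrow> cball (c i) (r i) \<inter> cball (c j) (r j) = {}"
          using C(3) ij I(1) by (auto simp only: pairwise_def disjnt_def)
        ultimately show "i = j" by fastforce
      qed
      have "p tagged_partial_division_of (cbox a b)"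
        unfolding tagged_partial_division_of_def
      proof (intro conjI allI impI)
        show "finite p" using I by (simp add: p_def)
      next
        fix x k assume "(x, k) \<in> p"
        then obtain i where i: "i \<in> I" "x = fst i" "k = cball (c i) (r i)" by (auto simp: p_def)
        have "i \<in> K" using i I C by auto
        then have "fst i \<in> {a..b}" "snd i \<in> {a..b}" by (auto simp: K_def)
        then show "x \<in> k" "k \<subseteq> cbox a b" "\<exists>a b. k = cbox a b"
          unfolding i cb by auto
      next
        fix x1 k1 x2 k2 assume *: "(x1, k1) \<in> p \<and> (x2, k2) \<in> p \<and> (x1, k1) \<noteq> (x2, k2)"
        then obtain i j where ij: "i \<in> I" "j \<in> I" "k1 = cball (c i) (r i)" "k2 = cball (c j) (r j)" "i \<noteq> j"
          by (auto simp: p_def)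
        then have "disjnt k1 k2" using C(3) I(1) by (auto simp: pairwise_def)
        then show "interior k1 \<inter> interior k2 = {}"
          using interior_subset by (fastforce simp: disjnt_def)
      qed
      moreover have "\<gamma> fine p"
        using I C by (fastforce simp: fine_def p_def cb K_def)
      ultimately have "(\<Sum>(x,k)\<in>p. norm (measure lborel k *\<^sub>R g x - integral k g)) < e * \<epsilon>"
        by (rule \<gamma>)
      also have "(\<Sum>(x,k)\<in>p. norm (measure lborel k *\<^sub>R g x - integral k g)) =
        (\<Sum>i\<in>I. norm (measure lborel (cball (c i) (r i)) *\<^sub>R g (fst i) - integral (cball (c i) (r i)) g))"
        unfolding p_def using inj by (subst sum.reindex) auto
      finally have lt: "\<dots> < e * \<epsilon>" .
      have "e * measure lborel (cball (c i) (r i)) \<le>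
          norm (measure lborel (cball (c i) (r i)) *\<^sub>R g (fst i) - integral (cball (c i) (r i)) g)" if "i \<in> I" for i
      proof -
        obtain x y where i: "i = (x, y)" by (cases i)
        have "(x, y) \<in> K" using that I C i by auto
        then have xy: "x \<in> {a..b}" "y \<in> {a..b}" "norm (F y - F x - (y - x) *\<^sub>R g x) > e * \<bar>y - x\<bar>"
          by (auto simp: K_def)
        show ?thesis
        proof (cases "x \<le> y")
          case True
          then show ?thesis using xy F_diff[OF xy(1,2)] norm_minus_commute[of "F y - F x"]
            unfolding i cb by (simp add: min_def max_def)
        next
          case False
          then have "norm (F y - F x - (y - x) *\<^sub>R g x) = norm ((x - y) *\<^sub>R g x - (F x - F y))"
            by (simp add: algebra_simps)
          with False show ?thesis using xy F_diff[OF xy(1,2)]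
            unfolding i cb by (simp add: min_def max_def)
        qed
      qed
      then have "e * (\<Sum>i\<in>I. measure lborel (cball (c i) (r i))) < e * \<epsilon>"
        unfolding sum_distrib_left by (intro le_less_trans[OF sum_mono lt])
      then have "(\<Sum>i\<in>I. measure lborel (cball (c i) (r i))) < \<epsilon>" using \<open>e > 0\<close> by simp
      moreover have "measure lebesgue (\<Union>i\<in>I. cball (c i) (r i)) \<le> (\<Sum>i\<in>I. measure lebesgue (cball (c i) (r i)))"
        by (intro measure_UNION_le I) auto
      ultimately show ?thesis by simp
    qed
    let ?U = "\<Union>i\<in>C. cball (c i) (r i)"
    have U: "?U \<in> lmeasurable" "measure lebesgue ?U \<le> \<epsilon>"
      using fmeasurable_UN_bound[OF C(1) _ meas] measure_UN_bound[OF C(1) _ meas] by auto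
    show "\<exists>T. E e \<subseteq> T \<and> T \<in> lmeasurable \<and> measure lebesgue T \<le> \<epsilon>"
    proof (intro exI conjI)
      show "E e \<subseteq> ?U \<union> (E e - ?U)" by auto
      show "?U \<union> (E e - ?U) \<in> lmeasurable"
        by (rule fmeasurable.Un[OF U(1) negligible_imp_measurable[OF negC]])
      have "measure lebesgue (E e - ?U) = 0"
        by (rule negligible_imp_measure0[OF negC])
      then show "measure lebesgue (?U \<union> (E e - ?U)) \<le> \<epsilon>"
        using U(2) measure_Un_le[OF fmeasurableD[OF U(1)] negligible_imp_sets[OF negC]] by linarith
    qed
  qed
  have "{x\<in>{a..b}. \<not> (F has_vector_derivative g x) (at x within {a..b})} \<subseteq> (\<Union>n. E (1 / Suc n))"
  proof clarify
    fix x assume x: "x \<in> {a..b}" "\<not> (F has_vector_derivative g x) (at x within {a..b})"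
    then obtain e where "e > 0" and e: "\<forall>d>0. \<exists>y\<in>{a..b}. \<bar>y - x\<bar> < d \<and>
        norm (F y - F x - (y - x) *\<^sub>R g x) > e * \<bar>y - x\<bar>"
      unfolding has_vector_derivative_def has_derivative_within_alt
      by (auto simp: bounded_linear_scaleR_left not_le)
    obtain n where n: "1 / Suc n < e" using \<open>e > 0\<close> nat_approx_posE by metis
    have "x \<in> E (1 / Suc n)"
      unfolding E_def
    proof (intro CollectI conjI allI impI)
      fix d :: real assume "d > 0"
      then obtain y where y: "y \<in> {a..b}" "\<bar>y - x\<bar> < d" "norm (F y - F x - (y - x) *\<^sub>R g x) > e * \<bar>y - x\<bar>"
        using e by blast
      have "1 / Suc n * \<bar>y - x\<bar> \<le> e * \<bar>y - x\<bar>" by (intro mult_right_mono) (use n in auto)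
      with y show "\<exists>y\<in>{a..b}. \<bar>y - x\<bar> < d \<and> 1 / real (Suc n) * \<bar>y - x\<bar> < norm (F y - F x - (y - x) *\<^sub>R g x)"
        by (intro bexI[of _ y]) auto
    qed (use x in auto)
    then show "x \<in> (\<Union>n. E (1 / Suc n))" by blast
  qed
  moreover have "negligible (\<Union>n. E (1 / Suc n))"
    by (intro negligible_countable_Union) (use neg in auto)
  ultimately show ?thesis using negligible_subset unfolding F_def by blast
qed

subsection \<open>Variation and absolute continuity\<close>

lemma increment_cbox:
  "a \<le> b \<Longrightarrow> increment f {a..b} = f b - f a"
  by (simp add: increment_def)

lemma division_of_realE:
  fixes D :: "real set set"
  assumes "D division_of S" "K \<in> D"
  obtains u v where "K = {u..v}" "u \<le> v" "{u..v} \<subseteq> S"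
  using division_ofD(2,3,4)[OF assms] by (metis atLeastatMost_empty_iff2 box_real(2))

lemma degenerate_of_interior_empty:
  fixes K :: "real set"
  assumes "K = {u..v}" "u \<le> v" "interior K = {}"
  shows "K = {u}"
  using assms by (cases "u < v") (auto simp: interior_atLeastAtMost_real)

lemma increment_singleton [simp]: "increment f {u} = 0"
  by (simp add: increment_def)

text \<open>An interval can occur in the subdivisions of two different pieces, but then its interior
  is empty, so it is a single point and \<open>\<phi>\<close> vanishes on it. Hence summing over
  pairs instead of over the union changes nothing.\<close>

lemma sum_UN_division:
  fixes D :: "real set set" and \<phi> :: "real set \<Rightarrow> real"
  assumes D: "D division_of S" and DD: "\<And>K. K \<in> D \<Longrightarrow> DD K division_of K"
    and \<phi>: "\<And>u. \<phi> {u} = 0"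
  shows "(\<Sum>L\<in>(\<Union>K\<in>D. DD K). \<phi> L) = (\<Sum>K\<in>D. \<Sum>L\<in>DD K. \<phi> L)"
proof -
  have fin: "finite D" "\<And>K. K \<in> D \<Longrightarrow> finite (DD K)" using D DD by auto
  have "(\<Sum>L\<in>snd ` (SIGMA K:D. DD K). \<phi> L) = (\<Sum>p\<in>(SIGMA K:D. DD K). (\<phi> \<circ> snd) p)"
  proof (rule sum.reindex_nontrivial)
    fix p q assume pq: "p \<in> Sigma D DD" "q \<in> Sigma D DD" "p \<noteq> q" "snd p = snd q"
    define K1 K2 L where "K1 = fst p" and "K2 = fst q" and "L = snd p"
    then have L: "K1 \<in> D" "K2 \<in> D" "L \<in> DD K1" "L \<in> DD K2" "p = (K1, L)" "K1 \<noteq> K2"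
      using pq by (auto simp: prod_eq_iff)
    then have "interior L \<subseteq> interior K1" "interior L \<subseteq> interior K2"
      using DD by (meson division_ofD(2) interior_mono)+
    then have "interior L = {}" using division_ofD(5)[OF D, of K1 K2] L by auto
    moreover obtain u v where "L = {u..v}" "u \<le> v" using division_of_realE[OF DD] L by metis
    ultimately have "L = {u}" by (metis degenerate_of_interior_empty)
    then show "\<phi> (snd p) = 0" using L \<phi> by simp
  qed (use fin in auto)
  moreover have "snd ` (SIGMA K:D. DD K) = (\<Union>K\<in>D. DD K)" by force
  ultimately show ?thesis by (subst sum.Sigma) (auto simp: fin split_def)
qed

lemma division_of_UN:
  assumes D: "D division_of S" and DD: "\<And>K. K \<in> D \<Longrightarrow> DD K division_of K"
  shows "(\<Union>K\<in>D. DD K) division_of S"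
proof (rule division_ofI)
  show "finite (\<Union>K\<in>D. DD K)" using D DD by auto
  show "\<Union>(\<Union>K\<in>D. DD K) = S"
    using division_ofD(6)[OF D] division_ofD(6)[OF DD] by fastforce
  then show "L \<subseteq> S" if "L \<in> (\<Union>K\<in>D. DD K)" for L using that by blast
  show "L \<noteq> {}" "\<exists>a b. L = cbox a b" if "L \<in> (\<Union>K\<in>D. DD K)" for L
    using that division_ofD(3,4)[OF DD] by blast+
  fix L1 L2 assume "L1 \<in> (\<Union>K\<in>D. DD K)" "L2 \<in> (\<Union>K\<in>D. DD K)" "L1 \<noteq> L2"
  then obtain K1 K2 where K: "K1 \<in> D" "K2 \<in> D" "L1 \<in> DD K1" "L2 \<in> DD K2" by auto
  show "interior L1 \<inter> interior L2 = {}"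
  proof (cases "K1 = K2")
    case True
    then show ?thesis using division_ofD(5)[OF DD] K \<open>L1 \<noteq> L2\<close> by blast
  next
    case False
    have "interior L1 \<subseteq> interior K1" "interior L2 \<subseteq> interior K2"
      using DD K by (meson division_ofD(2) interior_mono)+
    then show ?thesis using division_ofD(5)[OF D] K False by blast
  qed
qed

section \<open>Total variation and its additivity\<close>

definition variation :: "(real \<Rightarrow> 'a::real_normed_vector) \<Rightarrow> real \<Rightarrow> real \<Rightarrow> real" where
  "variation f a b = (SUP D\<in>{D. D division_of {a..b}}. \<Sum>K\<in>D. norm (increment f K))"

lemma sum_le_variation:
  assumes "bounded_variation_on f S" "{a..b} \<subseteq> S" "D division_of {a..b}"
  shows "(\<Sum>K\<in>D. norm (increment f K)) \<le> variation f a b"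
  unfolding variation_def
proof (rule cSUP_upper)
  show "bdd_above ((\<lambda>D. \<Sum>K\<in>D. norm (increment f K)) ` {D. D division_of {a..b}})"
    using assms(1,2) unfolding bounded_variation_on_def bdd_above_def by blast
qed (use assms in auto)

lemma variation_le:
  assumes "a \<le> b" "\<And>D. D division_of {a..b} \<Longrightarrow> (\<Sum>K\<in>D. norm (increment f K)) \<le> B"
  shows "variation f a b \<le> B"
  unfolding variation_def
proof (rule cSUP_least)
  have "{{a..b}} division_of {a..b}" using assms(1) division_of_self[of a b] by simp
  then show "{D. D division_of {a..b}} \<noteq> {}" by blast
qed (use assms in auto)

lemma norm_diff_le_variation:
  assumes "bounded_variation_on f S" "{a..b} \<subseteq> S" "a \<le> b"
  shows "norm (f b - f a) \<le> variation f a b"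
proof -
  have "{{a..b}} division_of {a..b}" using assms(3) division_of_self[of a b] by simp
  from sum_le_variation[OF assms(1,2) this] show ?thesis using assms(3) by (simp add: increment_cbox)
qed

text \<open>Cutting every piece at \<open>c\<close> can only increase the sum, by the triangle
  inequality on pieces that contain \<open>c\<close>.\<close>

lemma sum_norm_increment_split:
  fixes f :: "real \<Rightarrow> 'a::real_normed_vector"
  assumes D: "D division_of {a..b}" and c: "a \<le> c" "c \<le> b"
  obtains D1 D2 where "D1 division_of {a..c}" "D2 division_of {c..b}"
    "(\<Sum>K\<in>D. norm (increment f K)) \<le> (\<Sum>K\<in>D1. norm (increment f K)) + (\<Sum>K\<in>D2. norm (increment f K))"
proof -
  \<comment> \<open>The inner product with \<open>1\<close> is the form in which
    \<open>division_split\<close> cuts a division by a hyperplane.\<close>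
  define D1 where "D1 = {l \<inter> {x. x \<bullet> 1 \<le> c} | l. l \<in> D \<and> l \<inter> {x. x \<bullet> 1 \<le> c} \<noteq> {}}"
  define D2 where "D2 = {l \<inter> {x. x \<bullet> 1 \<ge> c} | l. l \<in> D \<and> l \<inter> {x. x \<bullet> 1 \<ge> c} \<noteq> {}}"
  have D': "D division_of cbox a b" and finD: "finite D" using D by auto
  have eq1: "cbox a b \<inter> {x. x \<bullet> 1 \<le> c} = {a..c}" and eq2: "cbox a b \<inter> {x. x \<bullet> 1 \<ge> c} = {c..b}"
    using c by auto
  have D1: "D1 division_of {a..c}" and D2: "D2 division_of {c..b}"
    using division_split[OF D', of 1 c] unfolding D1_def D2_def eq1 eq2 by auto
  \<comment> \<open>One half of a cut piece may be empty, where \<open>increment\<close> carries no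
    information; \<open>\<phi>\<close> gives it the value 0.\<close>
  define \<phi> where "\<phi> K = (if K = {} then 0 else norm (increment f K))" for K
  have \<phi>0: "\<phi> K = 0" if "interior K = {}" "K = {u..v}" for K u v
    using that by (cases "u \<le> v") (auto simp: \<phi>_def dest!: degenerate_of_interior_empty)
  have le: "norm (increment f K) \<le> \<phi> (K \<inter> {..c}) + \<phi> (K \<inter> {c..})" if KD: "K \<in> D" for K
  proof -
    obtain u v where K: "K = {u..v}" "u \<le> v" using division_of_realE[OF D KD] by metis
    have tri: "norm (f v - f u) \<le> norm (f c - f u) + norm (f v - f c)"
      using norm_triangle_ineq[of "f c - f u" "f v - f c"] by simp
    consider "v < c" | "c < u" | "u \<le> c" "c \<le> v" by linarith
    then show ?thesis
    proof cases
      case 1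
      then have "K \<inter> {..c} = K" using K by auto
      then show ?thesis using K by (auto simp: \<phi>_def)
    next
      case 2
      then have "K \<inter> {c..} = K" using K by auto
      then show ?thesis using K by (auto simp: \<phi>_def)
    next
      case 3
      then have "K \<inter> {..c} = {u..c}" "K \<inter> {c..} = {c..v}" using K by auto
      then show ?thesis using K 3 tri by (auto simp: \<phi>_def increment_cbox)
    qed
  qed
  have s1: "(\<Sum>K\<in>D. \<phi> (K \<inter> {..c})) = (\<Sum>K\<in>D1. norm (increment f K))"
  proof -
    have D1eq: "D1 = (\<lambda>K. K \<inter> {..c}) ` {K\<in>D. K \<inter> {..c} \<noteq> {}}"
      unfolding D1_def by (auto simp: atMost_def)
    have "(\<Sum>K\<in>D1. norm (increment f K)) = (\<Sum>K\<in>D1. \<phi> K)"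
      by (rule sum.cong) (use D1 in \<open>auto simp: \<phi>_def\<close>)
    also have "\<dots> = (\<Sum>K\<in>{K\<in>D. K \<inter> {..c} \<noteq> {}}. (\<phi> \<circ> (\<lambda>K. K \<inter> {..c})) K)"
      unfolding D1eq
    proof (rule sum.reindex_nontrivial)
      \<comment> \<open>Different pieces can have the same trace on the half-line only if this trace
        has empty interior, and then it contributes 0.\<close>
      fix K L assume *: "K \<in> {K \<in> D. K \<inter> {..c} \<noteq> {}}" "L \<in> {K \<in> D. K \<inter> {..c} \<noteq> {}}" "K \<noteq> L"
        "K \<inter> {..c} = L \<inter> {..c}"
      obtain u v where K: "K = {u..v}" using division_of_realE[OF D] * by blast
      have "interior (K \<inter> {x. x \<bullet> 1 \<le> c}) = {}"
        by (rule division_split_left_inj[OF D]) (use * in \<open>auto simp: atMost_def\<close>)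
      moreover have "K \<inter> {x. x \<bullet> 1 \<le> c} = {u..min v c}" "K \<inter> {..c} = {u..min v c}" using K by auto
      ultimately show "\<phi> (K \<inter> {..c}) = 0" using \<phi>0 by metis
    qed (use finD in auto)
    also have "\<dots> = (\<Sum>K\<in>D. \<phi> (K \<inter> {..c}))"
      by (rule sum.mono_neutral_cong_left) (use finD in \<open>auto simp: \<phi>_def\<close>)
    finally show ?thesis ..
  qed
  have s2: "(\<Sum>K\<in>D. \<phi> (K \<inter> {c..})) = (\<Sum>K\<in>D2. norm (increment f K))"
  proof -
    have D2eq: "D2 = (\<lambda>K. K \<inter> {c..}) ` {K\<in>D. K \<inter> {c..} \<noteq> {}}"
      unfolding D2_def by (auto simp: atLeast_def)
    have "(\<Sum>K\<in>D2. norm (increment f K)) = (\<Sum>K\<in>D2. \<phi> K)"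
      by (rule sum.cong) (use D2 in \<open>auto simp: \<phi>_def\<close>)
    also have "\<dots> = (\<Sum>K\<in>{K\<in>D. K \<inter> {c..} \<noteq> {}}. (\<phi> \<circ> (\<lambda>K. K \<inter> {c..})) K)"
      unfolding D2eq
    proof (rule sum.reindex_nontrivial)
      fix K L assume *: "K \<in> {K \<in> D. K \<inter> {c..} \<noteq> {}}" "L \<in> {K \<in> D. K \<inter> {c..} \<noteq> {}}" "K \<noteq> L"
        "K \<inter> {c..} = L \<inter> {c..}"
      obtain u v where K: "K = {u..v}" using division_of_realE[OF D] * by blast
      have "interior (K \<inter> {x. x \<bullet> 1 \<ge> c}) = {}"
        by (rule division_split_right_inj[OF D]) (use * in \<open>auto simp: atLeast_def\<close>)
      moreover have "K \<inter> {x. x \<bullet> 1 \<ge> c} = {max u c..v}" "K \<inter> {c..} = {max u c..v}" using K by auto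
      ultimately show "\<phi> (K \<inter> {c..}) = 0" using \<phi>0 by metis
    qed (use finD in auto)
    also have "\<dots> = (\<Sum>K\<in>D. \<phi> (K \<inter> {c..}))"
      by (rule sum.mono_neutral_cong_left) (use finD in \<open>auto simp: \<phi>_def\<close>)
    finally show ?thesis ..
  qed
  have "(\<Sum>K\<in>D. norm (increment f K)) \<le> (\<Sum>K\<in>D. \<phi> (K \<inter> {..c})) + (\<Sum>K\<in>D. \<phi> (K \<inter> {c..}))"
    unfolding sum.distrib[symmetric] by (rule sum_mono) (rule le)
  with that[OF D1 D2] show thesis unfolding s1 s2 by blast
qed

lemma variation_split_le:
  assumes "bounded_variation_on f S" "{a..b} \<subseteq> S" "a \<le> c" "c \<le> b"
  shows "variation f a b \<le> variation f a c + variation f c b"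
proof (rule variation_le)
  fix D assume "D division_of {a..b}"
  then obtain D1 D2 where D: "D1 division_of {a..c}" "D2 division_of {c..b}"
    "(\<Sum>K\<in>D. norm (increment f K)) \<le> (\<Sum>K\<in>D1. norm (increment f K)) + (\<Sum>K\<in>D2. norm (increment f K))"
    using sum_norm_increment_split[of D a b c f] assms by metis
  have "{a..c} \<subseteq> S" "{c..b} \<subseteq> S" using assms by auto
  with D show "(\<Sum>K\<in>D. norm (increment f K)) \<le> variation f a c + variation f c b"
    using sum_le_variation[OF assms(1)] by (meson add_mono order_trans)
qed (use assms in simp)

text \<open>Divisions of the two halves together divide the whole interval. The two suprema are then
  taken one after the other, each time with the remaining terms moved to the right-hand
  side.\<close>

lemma variation_split_ge:
  fixes f :: "real \<Rightarrow> 'a::real_normed_vector"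
  assumes "bounded_variation_on f S" "{a..b} \<subseteq> S" "a \<le> c" "c \<le> b"
  shows "variation f a c + variation f c b \<le> variation f a b"
proof -
  have *: "(\<Sum>K\<in>D1. norm (increment f K)) + (\<Sum>K\<in>D2. norm (increment f K)) \<le> variation f a b"
    if D1: "D1 division_of {a..c}" and D2: "D2 division_of {c..b}" for D1 D2
  proof -
    have fin: "finite D1" "finite D2" using D1 D2 by auto
    have "interior {a..c} \<inter> interior {c..b} = {}" by (auto simp: interior_atLeastAtMost_real)
    from division_disjoint_union[OF D1 D2 this] have D: "(D1 \<union> D2) division_of {a..b}"
      using assms by (simp add: ivl_disj_un_two_touch)
    \<comment> \<open>The union counts a common piece only once; the only possible common piece is
      \<open>{c}\<close>, whose increment is 0.\<close>
    have "(\<Sum>K\<in>D1 \<inter> D2. norm (increment f K)) = 0"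
    proof (rule sum.neutral, clarify)
      fix K assume K: "K \<in> D1" "K \<in> D2"
      obtain u v where uv: "K = {u..v}" "u \<le> v" using division_of_realE[OF D1 K(1)] by metis
      have "K \<subseteq> {c}" using division_ofD(2)[OF D1 K(1)] division_ofD(2)[OF D2 K(2)] by fastforce
      moreover have "u \<in> K" "v \<in> K" using uv by auto
      ultimately have "K = {c}" by blast
      then show "norm (increment f K) = 0" by simp
    qed
    then have "(\<Sum>K\<in>D1. norm (increment f K)) + (\<Sum>K\<in>D2. norm (increment f K)) =
        (\<Sum>K\<in>D1 \<union> D2. norm (increment f K))"
      using sum.union_inter[OF fin, of "\<lambda>K. norm (increment f K)"] by simp
    also have "\<dots> \<le> variation f a b" by (rule sum_le_variation[OF assms(1,2) D])
    finally show ?thesis .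
  qed
  have "variation f a c \<le> variation f a b - variation f c b"
  proof (rule variation_le)
    fix D1 assume D1: "D1 division_of {a..c}"
    have "variation f c b \<le> variation f a b - (\<Sum>K\<in>D1. norm (increment f K))"
      by (rule variation_le) (use assms *[OF D1] in \<open>auto simp: algebra_simps\<close>)
    then show "(\<Sum>K\<in>D1. norm (increment f K)) \<le> variation f a b - variation f c b" by simp
  qed (use assms in simp)
  then show ?thesis by simp
qed

lemma variation_combine:
  assumes "bounded_variation_on f S" "{a..b} \<subseteq> S" "a \<le> c" "c \<le> b"
  shows "variation f a b = variation f a c + variation f c b"
  using variation_split_le[OF assms] variation_split_ge[OF assms] by simp

lemma variation_approx:
  assumes "a \<le> b" "\<eta> > 0"
  shows "\<exists>D. D division_of {a..b} \<and> variation f a b < (\<Sum>K\<in>D. norm (increment f K)) + \<eta>"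
proof (rule ccontr)
  assume "\<not> ?thesis"
  then have "variation f a b \<le> variation f a b - \<eta>"
    by (intro variation_le) (use assms in \<open>force simp: not_less\<close>)+
  then show False using assms by simp
qed

text \<open>Each piece is replaced by a nearly optimal subdivision of it. This leaves the total
  length unchanged, so a \<open>\<delta>\<close> that serves \<open>f\<close> with
  \<open>\<epsilon> / 2\<close> serves the variation with \<open>\<epsilon>\<close>.\<close>

lemma abs_continuous_on_variation:
  fixes f :: "real \<Rightarrow> 'a::real_normed_vector"
  assumes bv: "bounded_variation_on f {0..}" and ac: "abs_continuous_on f {0..N}"
  shows "abs_continuous_on (variation f 0) {0..N}"
  unfolding abs_continuous_on_def
proof (intro allI impI)
  fix \<epsilon> :: real assume "\<epsilon> > 0"
  then obtain \<delta> where "\<delta> > 0" and \<delta>: "\<And>D. \<lbrakk>D division_of \<Union>D; \<Union>D \<subseteq> {0..N}; (\<Sum>K\<in>D. measure lborel K) < \<delta>\<rbrakk>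
      \<Longrightarrow> (\<Sum>K\<in>D. norm (increment f K)) < \<epsilon> / 2"
    using ac unfolding abs_continuous_on_def by (metis half_gt_zero)
  show "\<exists>\<delta>>0. \<forall>D. D division_of \<Union>D \<and> \<Union>D \<subseteq> {0..N} \<and> (\<Sum>K\<in>D. measure lborel K) < \<delta> \<longrightarrow>
          (\<Sum>K\<in>D. norm (increment (variation f 0) K)) < \<epsilon>"
  proof (intro exI[of _ \<delta>] conjI allI impI \<open>\<delta> > 0\<close>)
    fix D assume "D division_of \<Union>D \<and> \<Union>D \<subseteq> {0..N} \<and> (\<Sum>K\<in>D. measure lborel K) < \<delta>"
    then have D: "D division_of \<Union>D" "\<Union>D \<subseteq> {0..N}" "(\<Sum>K\<in>D. measure lborel K) < \<delta>" by auto
    \<comment> \<open>The error \<open>\<eta>\<close> is made once per piece, and the errors may add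
      up to \<open>\<epsilon> / 2\<close>; the \<open>+ 1\<close> keeps the denominator positive for
      empty \<open>D\<close>.\<close>
    define \<eta> where "\<eta> = \<epsilon> / (2 * (real (card D) + 1))"
    have "\<eta> > 0" using \<open>\<epsilon> > 0\<close> by (simp add: \<eta>_def)
    have "\<exists>E. E division_of K \<and> norm (increment (variation f 0) K) < (\<Sum>L\<in>E. norm (increment f L)) + \<eta>"
      if K: "K \<in> D" for K
    proof -
      obtain u v where uv: "K = {u..v}" "u \<le> v" "{u..v} \<subseteq> \<Union>D"
        using division_of_realE[OF D(1) K] by metis
      then have "u \<in> \<Union>D" by auto
      then have "u \<ge> 0" using D(2) by auto
      have "variation f 0 v = variation f 0 u + variation f u v"
        by (rule variation_combine[OF bv]) (use uv \<open>u \<ge> 0\<close> in auto)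
      moreover have "norm (f v - f u) \<le> variation f u v"
        by (rule norm_diff_le_variation[OF bv]) (use uv \<open>u \<ge> 0\<close> in auto)
      ultimately have "norm (increment (variation f 0) K) = variation f u v"
        using uv norm_ge_zero[of "f v - f u"] by (simp add: increment_cbox del: norm_ge_zero)
      then show ?thesis using variation_approx[OF uv(2) \<open>\<eta> > 0\<close>] uv(1) by metis
    qed
    then obtain E where E: "\<And>K. K \<in> D \<Longrightarrow> E K division_of K"
      "\<And>K. K \<in> D \<Longrightarrow> norm (increment (variation f 0) K) < (\<Sum>L\<in>E K. norm (increment f L)) + \<eta>"
      by metis
    let ?D = "\<Union>K\<in>D. E K"
    have D': "?D division_of \<Union>D" by (rule division_of_UN[OF D(1) E(1)])
    then have U: "\<Union>?D = \<Union>D" by (rule division_ofD(6))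
    have "(\<Sum>L\<in>?D. measure lborel L) = (\<Sum>K\<in>D. \<Sum>L\<in>E K. measure lborel L)"
      by (rule sum_UN_division[OF D(1) E(1)]) auto
    also have "\<dots> = (\<Sum>K\<in>D. measure lborel K)"
    proof (rule sum.cong[OF refl])
      fix K assume K: "K \<in> D"
      then obtain u v where uv: "K = cbox u v" using division_ofD(4)[OF D(1)] by metis
      then show "(\<Sum>L\<in>E K. measure lborel L) = measure lborel K"
        using additive_content_division[of "E K" u v] E(1)[OF K] by simp
    qed
    finally have "(\<Sum>L\<in>?D. norm (increment f L)) < \<epsilon> / 2"
      using D D' U by (intro \<delta>) auto
    also have "(\<Sum>L\<in>?D. norm (increment f L)) = (\<Sum>K\<in>D. \<Sum>L\<in>E K. norm (increment f L))"
      by (rule sum_UN_division[OF D(1) E(1)]) auto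
    finally have lt: "(\<Sum>K\<in>D. \<Sum>L\<in>E K. norm (increment f L)) < \<epsilon> / 2" .
    have "(\<Sum>K\<in>D. norm (increment (variation f 0) K)) \<le> (\<Sum>K\<in>D. (\<Sum>L\<in>E K. norm (increment f L)) + \<eta>)"
      by (rule sum_mono) (use E(2) in \<open>auto intro: less_imp_le\<close>)
    also have "\<dots> = (\<Sum>K\<in>D. \<Sum>L\<in>E K. norm (increment f L)) + real (card D) * \<eta>"
      by (simp add: sum.distrib)
    also have "real (card D) * \<eta> \<le> \<epsilon> / 2" using \<open>\<epsilon> > 0\<close> by (simp add: \<eta>_def field_simps)
    finally show "(\<Sum>K\<in>D. norm (increment (variation f 0) K)) < \<epsilon>" using lt by simp
  qed
qed

subsection \<open>Densities of absolutely continuous functions\<close>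

lemma abs_continuous_on_small_increment:
  fixes P :: "real \<Rightarrow> 'a::real_normed_vector"
  assumes "abs_continuous_on P {a..b}" "\<epsilon> > 0"
  obtains \<delta> where "\<delta> > 0" "\<And>x y. \<lbrakk>x \<in> {a..b}; y \<in> {a..b}; \<bar>x - y\<bar> < \<delta>\<rbrakk> \<Longrightarrow> norm (P x - P y) < \<epsilon>"
proof -
  obtain \<delta> where "\<delta> > 0" and \<delta>: "\<And>D. \<lbrakk>D division_of \<Union>D; \<Union>D \<subseteq> {a..b}; (\<Sum>K\<in>D. measure lborel K) < \<delta>\<rbrakk>
      \<Longrightarrow> (\<Sum>K\<in>D. norm (increment P K)) < \<epsilon>"
    using assms unfolding abs_continuous_on_def by metis
  have *: "norm (P y - P x) < \<epsilon>" if "x \<in> {a..b}" "y \<in> {a..b}" "x \<le> y" "y - x < \<delta>" for x y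
  proof -
    have "{{x..y}} division_of \<Union>{{x..y}}" using division_of_self[of x y] that by simp
    from \<delta>[OF this] show ?thesis using that by (simp add: increment_cbox)
  qed
  show thesis
  proof (rule that[OF \<open>\<delta> > 0\<close>])
    fix x y assume "x \<in> {a..b}" "y \<in> {a..b}" "\<bar>x - y\<bar> < \<delta>"
    then show "norm (P x - P y) < \<epsilon>"
      using *[of x y] *[of y x] by (cases "x \<le> y") (auto simp: norm_minus_commute)
  qed
qed

lemma continuous_of_abs_continuous:
  fixes P :: "real \<Rightarrow> 'a::real_normed_vector"
  assumes ac: "\<And>N. abs_continuous_on P {0..N}" and const: "\<And>x. x \<le> 0 \<Longrightarrow> P x = P 0"
  shows "continuous_on UNIV P"
  unfolding continuous_on_iff
proof (intro ballI allI impI)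
  fix x \<epsilon> :: real assume "\<epsilon> > 0"
  \<comment> \<open>The bound \<open>\<bar>x\<bar> + 1\<close> leaves room for every
    \<open>y\<close> at distance less than 1 from \<open>x\<close>, after negative points have been
    moved to 0.\<close>
  obtain \<delta> where "\<delta> > 0" and \<delta>: "\<And>u v. \<lbrakk>u \<in> {0..\<bar>x\<bar>+1}; v \<in> {0..\<bar>x\<bar>+1}; \<bar>u - v\<bar> < \<delta>\<rbrakk> \<Longrightarrow> norm (P u - P v) < \<epsilon>"
    using abs_continuous_on_small_increment[OF ac \<open>\<epsilon> > 0\<close>] by metis
  have P: "P y = P (max 0 y)" for y using const[of y] by (auto simp: max_def)
  show "\<exists>d>0. \<forall>y\<in>UNIV. dist y x < d \<longrightarrow> dist (P y) (P x) < \<epsilon>"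
  proof (intro exI[of _ "min 1 \<delta>"] conjI ballI impI)
    fix y assume y: "dist y x < min 1 \<delta>"
    have "norm (P (max 0 y) - P (max 0 x)) < \<epsilon>"
      by (rule \<delta>) (use y in \<open>auto simp: dist_real_def max_def\<close>)
    then show "dist (P y) (P x) < \<epsilon>" using P by (simp add: dist_norm)
  qed (use \<open>\<delta> > 0\<close> in auto)
qed

lemma sum_measure_division_le:
  fixes F :: "real set set"
  assumes F: "F division_of \<Union>F" and U: "\<Union>F \<subseteq> U" "U \<in> sets borel" "emeasure lborel U < ennreal \<delta>"
  shows "(\<Sum>K\<in>F. measure lborel K) < \<delta>"
proof -
  have K: "K \<in> lmeasurable" "measure lebesgue K = measure lborel K" "convex K" if "K \<in> F" for K
    using division_ofD(4)[OF F that] by (auto simp: measure_completion)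
  have Ub: "U \<in> lmeasurable"
    using U by (auto simp: fmeasurable_def intro: less_trans[OF _ ennreal_less_top])
  have "(\<Sum>K\<in>F. measure lborel K) = (\<Sum>K\<in>F. measure lebesgue K)"
    using K by simp
  also have "\<dots> = measure lebesgue (\<Union>F)"
  proof (rule measure_negligible_finite_Union[symmetric])
    show "pairwise (\<lambda>S T. negligible (S \<inter> T)) F"
      unfolding pairwise_def
      using division_ofD(5)[OF F] K(3) by (auto simp: negligible_convex_interior convex_Int)
  qed (use F K in auto)
  also have "\<dots> \<le> measure lebesgue U"
    using K F U(1) Ub by (intro measure_mono_fmeasurable fmeasurableD fmeasurable.finite_Union) auto
  also have "\<dots> = measure lborel U" using U by (simp add: measure_completion)
  also have "\<dots> < \<delta>"
    using U by (metis emeasure_eq_ennreal_measure ennreal_less_iff less_top measure_nonneg top.extremum_strict less_trans ennreal_less_top)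
  finally show ?thesis .
qed

text \<open>Absolute continuity speaks of finite families of intervals, outer regularity of an open
  set. The bridge is a countable cover of \<open>N\<close> by nonoverlapping compact intervals
  inside that open set: every finite subfamily has small total increment, hence small Stieltjes
  measure, and so has the union.\<close>

lemma mono_abs_continuous_null:
  fixes P :: "real \<Rightarrow> real"
  assumes mono: "\<And>x y. x \<le> y \<Longrightarrow> P x \<le> P y"
    and ac: "\<And>N. abs_continuous_on P {0..N}" and const: "\<And>x. x \<le> 0 \<Longrightarrow> P x = P 0"
    and N: "N \<in> null_sets lborel" "N \<subseteq> {0..real n}" and n: "n > 0"
  shows "emeasure (interval_measure P) N = 0"
proof -
  let ?\<mu> = "interval_measure P"
  have cont: "continuous_on UNIV P" by (rule continuous_of_abs_continuous[OF ac const])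
  have Icc: "emeasure ?\<mu> {a..b} = ennreal (P b - P a)" if "a \<le> b" for a b
    by (rule emeasure_interval_measure_Icc[OF that mono cont])
  have Nb: "N \<in> sets borel" using N by auto
  have fm: "N \<in> fmeasurable ?\<mu>"
    by (rule fmeasurableI2[of "{0..real n}"]) (use Icc[of 0 "real n"] N Nb in \<open>auto simp: fmeasurable_def\<close>)
  have "measure ?\<mu> N \<le> \<epsilon>" if "\<epsilon> > 0" for \<epsilon> :: real
  proof -
    obtain \<delta> where "\<delta> > 0" and \<delta>: "\<And>D. \<lbrakk>D division_of \<Union>D; \<Union>D \<subseteq> {0..real n}; (\<Sum>K\<in>D. measure lborel K) < \<delta>\<rbrakk>
        \<Longrightarrow> (\<Sum>K\<in>D. norm (increment P K)) < \<epsilon>"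
      using ac[of "real n"] \<open>\<epsilon> > 0\<close> unfolding abs_continuous_on_def by metis
    obtain U where U: "open U" "N \<subseteq> U" "emeasure lborel (U - N) < ennreal \<delta>"
      using outer_regular_lborel[OF Nb \<open>\<delta> > 0\<close>] by metis
    have Us: "emeasure lborel U < ennreal \<delta>"
      using U N by (metis borel_open emeasure_Diff_null_set sets_lborel)
    \<comment> \<open>With this gauge, an interval of the cover whose tag lies in \<open>N\<close>
      is contained in \<open>U\<close>.\<close>
    have g: "gauge (\<lambda>x. if x \<in> U then U else UNIV)" using U by (auto simp: gauge_def)
    obtain \<D> where D: "countable \<D>"  "\<Union>\<D> \<subseteq> {0..real n}"
      "\<And>K. K \<in> \<D> \<Longrightarrow> interior K \<noteq> {} \<and> (\<exists>c d. K = cbox c d)"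
      "pairwise (\<lambda>A B. interior A \<inter> interior B = {}) \<D>"
      "\<And>K. K \<in> \<D> \<Longrightarrow> \<exists>x \<in> N \<inter> K. K \<subseteq> (if x \<in> U then U else UNIV)"
      "N \<subseteq> \<Union>\<D>"
      by (rule covering_lemma[OF _ _ g, of N 0 "real n"]) (use N n in auto)
    have bound: "measure ?\<mu> (\<Union>K\<in>F. K) \<le> \<epsilon>" if F: "F \<subseteq> \<D>" "finite F" for F
    proof -
      have div: "F division_of \<Union>F"
      proof (rule division_ofI)
        fix K assume "K \<in> F"
        then have "K \<in> \<D>" using F by auto
        then show "K \<noteq> {}" "\<exists>a b. K = cbox a b" using D(3)[of K] by auto
      next
        fix K L assume "K \<in> F" "L \<in> F" "K \<noteq> L"
        then show "interior K \<inter> interior L = {}" using D(4) F by (auto simp: pairwise_def)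
      qed (use F in auto)
      have "\<Union>F \<subseteq> U" using D(5) F U(2) by fastforce
      then have "(\<Sum>K\<in>F. measure lborel K) < \<delta>"
        by (rule sum_measure_division_le[OF div]) (use U Us in auto)
      then have lt: "(\<Sum>K\<in>F. norm (increment P K)) < \<epsilon>" using \<delta>[OF div] F D(2) by blast
      have "measure ?\<mu> (\<Union>K\<in>F. K) \<le> (\<Sum>K\<in>F. measure ?\<mu> K)"
      proof (rule measure_UNION_le[OF F(2)])
        fix K assume "K \<in> F"
        then obtain u v where "K = cbox u v" using division_ofD(4)[OF div] by blast
        then show "K \<in> sets ?\<mu>" by simp
      qed
      also have "\<dots> = (\<Sum>K\<in>F. norm (increment P K))"
      proof (rule sum.cong[OF refl])
        fix K assume "K \<in> F"
        then obtain u v where uv: "K = {u..v}" "u \<le> v" using division_of_realE[OF div] by metis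
        then show "measure ?\<mu> K = norm (increment P K)"
          using mono[of u v] by (simp add: increment_cbox measure_def Icc)
      qed
      finally show ?thesis using lt by simp
    qed
    have fK: "K \<in> fmeasurable ?\<mu>" if KD: "K \<in> \<D>" for K
    proof -
      obtain u v where "K = cbox u v" using D(3)[OF KD] by blast
      then show ?thesis using Icc[of u v] by (cases "u \<le> v") (auto simp: fmeasurable_def)
    qed
    have "measure ?\<mu> N \<le> measure ?\<mu> (\<Union>K\<in>\<D>. K)"
      using D(6) Nb fmeasurable_UN_bound[OF D(1) fK bound]
      by (intro measure_mono_fmeasurable) auto
    also have "\<dots> \<le> \<epsilon>" by (rule measure_UN_bound[OF D(1) fK bound])
    finally show ?thesis .
  qed
  then have "measure ?\<mu> N \<le> 0" by (rule field_le_epsilon[of _ 0, simplified])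
  then show ?thesis using fm emeasure_eq_measure2 by (metis antisym ennreal_0 measure_nonneg)
qed

text \<open>The bound on \<open>P\<close> makes the Stieltjes measure finite, so that the
  Radon-Nikodym density is integrable over the whole line and not just locally.\<close>

lemma mono_abs_continuous_density:
  fixes P :: "real \<Rightarrow> real"
  assumes mono: "\<And>x y. x \<le> y \<Longrightarrow> P x \<le> P y"
    and ac: "\<And>N. abs_continuous_on P {0..N}" and const: "\<And>x. x \<le> 0 \<Longrightarrow> P x = P 0"
    and bdd: "\<And>x. P x - P 0 \<le> B"
  obtains h where "integrable lborel h" "\<And>a b. a \<le> b \<Longrightarrow> P b - P a = (LINT x|lborel. indicator {a..b} x * h x)"
proof -
  let ?\<mu> = "interval_measure P"
  have cont: "continuous_on UNIV P" by (rule continuous_of_abs_continuous[OF ac const])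
  have Icc: "emeasure ?\<mu> {a..b} = ennreal (P b - P a)" if "a \<le> b" for a b
    by (rule emeasure_interval_measure_Icc[OF that mono cont])
  have neg: "emeasure ?\<mu> {- real n..0} = 0" for n
    using Icc[of "- real n" 0] const[of "- real n"] by simp
  have "absolutely_continuous lborel ?\<mu>"
    unfolding absolutely_continuous_def
  proof
    fix N assume N: "N \<in> null_sets (lborel :: real measure)"
    then have Nb: "N \<in> sets borel" by auto
    have "N \<inter> {- real n..0} \<union> N \<inter> {0..real n} \<in> null_sets ?\<mu>" for n
    proof (intro null_sets.Un null_setsI)
      \<comment> \<open>The left half has no mass because \<open>P\<close> is constant there;
        absolute continuity is available on the right half only.\<close>
      show "emeasure ?\<mu> (N \<inter> {- real n..0}) = 0"
        using emeasure_mono[of "N \<inter> {- real n..0}" "{- real n..0}" ?\<mu>] neg[of n] by simp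
      have "N \<inter> {0..real n} \<in> null_sets lborel" using N by (intro null_set_Int2) auto
      \<comment> \<open>The interval is enlarged to \<open>Suc n\<close> because the covering
        argument needs a nondegenerate interval, also for \<open>n = 0\<close>.\<close>
      then have "N \<inter> {0..real n} \<in> null_sets lborel" "N \<inter> {0..real n} \<subseteq> {0..real (Suc n)}" by auto
      then show "emeasure ?\<mu> (N \<inter> {0..real n}) = 0"
        by - (rule mono_abs_continuous_null[of P _ "Suc n", OF mono ac const], auto)
    qed (use Nb in auto)
    then have "(\<Union>n. N \<inter> {- real n..0} \<union> N \<inter> {0..real n}) \<in> null_sets ?\<mu>"
      by (rule null_sets_UN)
    also have "(\<Union>n. N \<inter> {- real n..0} \<union> N \<inter> {0..real n}) = N"
    proof (intro equalityI subsetI)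
      fix x assume "x \<in> N"
      obtain n where "\<bar>x\<bar> \<le> real n" using real_arch_simple by blast
      then show "x \<in> (\<Union>n. N \<inter> {- real n..0} \<union> N \<inter> {0..real n})" using \<open>x \<in> N\<close>
        by (auto intro!: exI[of _ n])
    qed auto
    finally show "N \<in> null_sets ?\<mu>" .
  qed
  then obtain h where h: "h \<in> borel_measurable lborel" "density lborel h = ?\<mu>"
    using sigma_finite_measure.Radon_Nikodym[OF sigma_finite_lborel, of ?\<mu>] by auto
  have nn: "(\<integral>\<^sup>+x. h x * indicator A x \<partial>lborel) = emeasure ?\<mu> A" if "A \<in> sets borel" for A
    unfolding h(2)[symmetric] using h(1) that by (subst emeasure_density) auto
  have "emeasure ?\<mu> UNIV \<le> ennreal B"
  proof -
    have "emeasure ?\<mu> (\<Union>n. {- real n..real n}) = (SUP n. emeasure ?\<mu> {- real n..real n})"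
      by (rule SUP_emeasure_incseq[symmetric]) (auto simp: incseq_def)
    also have "\<dots> \<le> ennreal B"
    proof (rule SUP_least)
      fix n
      show "emeasure ?\<mu> {- real n..real n} \<le> ennreal B"
        using Icc[of "- real n" "real n"] const[of "- real n"] bdd[of "real n"] by (simp add: ennreal_leI)
    qed
    also have "(\<Union>n. {- real n..real n}) = UNIV"
    proof (intro equalityI subsetI UNIV_I)
      fix x :: real
      obtain n where "\<bar>x\<bar> \<le> real n" using real_arch_simple by blast
      then show "x \<in> (\<Union>n. {- real n..real n})" by (auto intro!: exI[of _ n])
    qed
    finally show ?thesis .
  qed
  then have fin: "(\<integral>\<^sup>+x. h x \<partial>lborel) < \<infinity>"
    using nn[of UNIV] by (auto intro: le_less_trans)
  then have ae: "AE x in lborel. h x \<noteq> \<infinity>"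
    using h(1) by (intro nn_integral_PInf_AE) auto
  \<comment> \<open>\<open>enn2real\<close> turns the value infinity into 0, which changes the
    density on a null set only.\<close>
  let ?h = "\<lambda>x. enn2real (h x)"
  have [measurable]: "h \<in> borel_measurable borel" using h(1) by simp
  have int: "integrable lborel ?h"
  proof (rule integrableI_nonneg)
    have "(\<integral>\<^sup>+x. ennreal (?h x) \<partial>lborel) = (\<integral>\<^sup>+x. h x \<partial>lborel)"
      by (rule nn_integral_cong_AE) (use ae in \<open>auto simp: ennreal_enn2real_if\<close>)
    then show "(\<integral>\<^sup>+x. ennreal (?h x) \<partial>lborel) < \<infinity>" using fin by simp
  qed auto
  show thesis
  proof (rule that[OF int])
    fix a b :: real assume "a \<le> b"
    have "(LINT x|lborel. indicator {a..b} x * ?h x) = enn2real (\<integral>\<^sup>+x. ennreal (indicator {a..b} x * ?h x) \<partial>lborel)"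
      by (rule integral_eq_nn_integral) auto
    also have "(\<integral>\<^sup>+x. ennreal (indicator {a..b} x * ?h x) \<partial>lborel) = (\<integral>\<^sup>+x. h x * indicator {a..b} x \<partial>lborel)"
      by (rule nn_integral_cong_AE) (use ae in \<open>auto simp: ennreal_enn2real_if split: split_indicator\<close>)
    also have "\<dots> = ennreal (P b - P a)" using nn[of "{a..b}"] Icc[OF \<open>a \<le> b\<close>] by simp
    finally show "P b - P a = (LINT x|lborel. indicator {a..b} x * ?h x)"
      using mono[OF \<open>a \<le> b\<close>] by simp
  qed
qed

lemma abs_continuous_on_dominated:
  fixes P :: "real \<Rightarrow> 'a::real_normed_vector" and Q :: "real \<Rightarrow> 'b::real_normed_vector"
    and R :: "real \<Rightarrow> 'c::real_normed_vector"
  assumes Q: "abs_continuous_on Q {a..b}" and R: "abs_continuous_on R {a..b}"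
    and le: "\<And>u v. \<lbrakk>u \<in> {a..b}; v \<in> {a..b}; u \<le> v\<rbrakk> \<Longrightarrow> norm (P v - P u) \<le> norm (Q v - Q u) + norm (R v - R u)"
  shows "abs_continuous_on P {a..b}"
  unfolding abs_continuous_on_def
proof (intro allI impI)
  fix \<epsilon> :: real assume "\<epsilon> > 0"
  then have "\<epsilon> / 2 > 0" by simp
  from Q[unfolded abs_continuous_on_def, rule_format, OF this]
  obtain d1 where d1: "d1 > 0" "\<And>D. D division_of \<Union>D \<and> \<Union>D \<subseteq> {a..b} \<and> (\<Sum>K\<in>D. measure lborel K) < d1
      \<Longrightarrow> (\<Sum>K\<in>D. norm (increment Q K)) < \<epsilon> / 2" by blast
  from R[unfolded abs_continuous_on_def, rule_format, OF \<open>\<epsilon> / 2 > 0\<close>]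
  obtain d2 where d2: "d2 > 0" "\<And>D. D division_of \<Union>D \<and> \<Union>D \<subseteq> {a..b} \<and> (\<Sum>K\<in>D. measure lborel K) < d2
      \<Longrightarrow> (\<Sum>K\<in>D. norm (increment R K)) < \<epsilon> / 2" by blast
  show "\<exists>\<delta>>0. \<forall>D. D division_of \<Union>D \<and> \<Union>D \<subseteq> {a..b} \<and> (\<Sum>K\<in>D. measure lborel K) < \<delta> \<longrightarrow>
          (\<Sum>K\<in>D. norm (increment P K)) < \<epsilon>"
  proof (intro exI[of _ "min d1 d2"] conjI allI impI)
    fix D assume D: "D division_of \<Union>D \<and> \<Union>D \<subseteq> {a..b} \<and> (\<Sum>K\<in>D. measure lborel K) < min d1 d2"
    have "(\<Sum>K\<in>D. norm (increment P K)) \<le> (\<Sum>K\<in>D. norm (increment Q K) + norm (increment R K))"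
    proof (rule sum_mono)
      fix K assume K: "K \<in> D"
      from D have "D division_of \<Union>D" by blast
      from division_of_realE[OF this K]
      obtain u v where uv: "K = {u..v}" "u \<le> v" "{u..v} \<subseteq> \<Union>D" .
      then have "{u..v} \<subseteq> {a..b}" using D by blast
      then show "norm (increment P K) \<le> norm (increment Q K) + norm (increment R K)"
        using le[of u v] uv by (simp add: increment_cbox)
    qed
    also have "\<dots> < \<epsilon>" using d1(2)[of D] d2(2)[of D] D by (simp add: sum.distrib)
    finally show "(\<Sum>K\<in>D. norm (increment P K)) < \<epsilon>" .
  qed (use d1 d2 in auto)
qed

lemma integrable_indicator_Icc_mult:
  fixes h :: "real \<Rightarrow> real"
  assumes "integrable lborel h"
  shows "integrable lborel (\<lambda>x. indicator {a..b} x * h x)"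
  using integrable_mult_indicator[OF _ assms, of "{a..b}"] by simp

text \<open>Jordan decomposition: \<open>V\<close> and \<open>V + \<phi> \<circ> f\<close> are both
  nondecreasing, since \<open>\<phi>\<close> is 1-Lipschitz and the increments of \<open>V\<close>
  dominate those of \<open>f\<close>. The difference of their densities is the density of
  \<open>\<phi> \<circ> f\<close>. Real and imaginary part are the instances of
  \<open>\<phi>\<close> in view.\<close>

lemma real_abs_continuous_density:
  fixes f :: "real \<Rightarrow> 'a::real_normed_vector" and \<phi> :: "'a \<Rightarrow> real"
  assumes ac: "\<And>N. abs_continuous_on f {0..N}" and bv: "bounded_variation_on f {0..}"
    and \<phi>: "\<And>x y. \<bar>\<phi> x - \<phi> y\<bar> \<le> norm (x - y)"
  obtains h where "integrable lborel h"
    "\<And>a b. \<lbrakk>0 \<le> a; a \<le> b\<rbrakk> \<Longrightarrow> \<phi> (f b) - \<phi> (f a) = (LINT x|lborel. indicator {a..b} x * h x)"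
proof -
  \<comment> \<open>The \<open>max\<close> continues both functions by constants to the left of 0,
    so that they define Stieltjes measures on the line without mass on the negative half.\<close>
  define V where "V x = variation f 0 (max 0 x)" for x
  define P where "P x = V x + \<phi> (f (max 0 x))" for x
  have V_diff: "V y - V x = variation f x y" if "0 \<le> x" "x \<le> y" for x y
    using variation_combine[OF bv, of 0 y x] that by (simp add: V_def)
  have V_ge: "norm (f y - f x) \<le> V y - V x" if "0 \<le> x" "x \<le> y" for x y
    unfolding V_diff[OF that] by (rule norm_diff_le_variation[OF bv]) (use that in auto)
  have max0: "V x = V (max 0 x)" "P x = P (max 0 x)" for x by (simp_all add: V_def P_def)
  have V_mono: "V x \<le> V y" if "x \<le> y" for x y
  proof -
    have "norm (f (max 0 y) - f (max 0 x)) \<le> V (max 0 y) - V (max 0 x)" by (rule V_ge) (use that in auto)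
    with norm_ge_zero[of "f (max 0 y) - f (max 0 x)"] show ?thesis
      unfolding max0(1)[of x] max0(1)[of y] by linarith
  qed
  have P_mono: "P x \<le> P y" if "x \<le> y" for x y
  proof -
    have "norm (f (max 0 y) - f (max 0 x)) \<le> V (max 0 y) - V (max 0 x)" by (rule V_ge) (use that in auto)
    with \<phi>[of "f (max 0 y)" "f (max 0 x)"] show ?thesis
      unfolding P_def max0(1)[of x] max0(1)[of y] by (simp add: V_def abs_le_iff)
  qed
  have V_ac: "abs_continuous_on V {0..N}" for N
    by (rule abs_continuous_on_dominated[OF abs_continuous_on_variation[OF bv ac] ac])
       (auto simp: V_def max_def)
  have P_ac: "abs_continuous_on P {0..N}" for N
  proof (rule abs_continuous_on_dominated[OF V_ac ac])
    fix u v assume "u \<in> {0..N}" "v \<in> {0..N}" "u \<le> v"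
    then show "norm (P v - P u) \<le> norm (V v - V u) + norm (f v - f u)"
      using \<phi>[of "f v" "f u"] by (auto simp: P_def max_def)
  qed
  obtain B where B: "\<And>a b D. {a..b} \<subseteq> {0..} \<Longrightarrow> D division_of {a..b} \<Longrightarrow> (\<Sum>K\<in>D. norm (increment f K)) \<le> B"
    using bv unfolding bounded_variation_on_def by blast
  have VB: "V x - V 0 \<le> B" for x
  proof -
    have "variation f 0 (max 0 x) \<le> B" by (rule variation_le) (auto intro!: B)
    moreover have "V 0 \<ge> 0"
      using norm_diff_le_variation[OF bv, of 0 0] by (simp add: V_def)
    ultimately show ?thesis by (simp add: V_def)
  qed
  \<comment> \<open>One \<open>B\<close> bounds the increase of \<open>V\<close>, the other that of
    \<open>\<phi> \<circ> f\<close>, which is dominated by the increase of \<open>V\<close>.\<close>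
  have PB: "P x - P 0 \<le> 2 * B" for x
  proof -
    have "norm (f (max 0 x) - f 0) \<le> V (max 0 x) - V 0" by (rule V_ge) auto
    then show ?thesis using VB[of x] \<phi>[of "f (max 0 x)" "f 0"] max0(1)[of x] by (simp add: P_def abs_le_iff)
  qed
  obtain h1 where h1: "integrable lborel h1" "\<And>a b. a \<le> b \<Longrightarrow> V b - V a = (LINT x|lborel. indicator {a..b} x * h1 x)"
    using mono_abs_continuous_density[OF V_mono V_ac _ VB] by (auto simp: V_def)
  obtain h2 where h2: "integrable lborel h2" "\<And>a b. a \<le> b \<Longrightarrow> P b - P a = (LINT x|lborel. indicator {a..b} x * h2 x)"
    using mono_abs_continuous_density[OF P_mono P_ac _ PB] by (auto simp: P_def V_def)
  show thesis
  proof (rule that)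
    show "integrable lborel (\<lambda>x. h2 x - h1 x)" using h1(1) h2(1) by auto
    fix a b :: real assume ab: "0 \<le> a" "a \<le> b"
    have "\<phi> (f b) - \<phi> (f a) = (P b - P a) - (V b - V a)" using ab by (simp add: P_def)
    also have "\<dots> = (LINT x|lborel. indicator {a..b} x * h2 x) - (LINT x|lborel. indicator {a..b} x * h1 x)"
      unfolding h1(2)[OF ab(2)] h2(2)[OF ab(2)] ..
    also have "\<dots> = (LINT x|lborel. indicator {a..b} x * h2 x - indicator {a..b} x * h1 x)"
      by (intro Bochner_Integration.integral_diff[symmetric] integrable_indicator_Icc_mult h1(1) h2(1))
    finally show "\<phi> (f b) - \<phi> (f a) = (LINT x|lborel. indicator {a..b} x * (h2 x - h1 x))"
      by (simp add: right_diff_distrib)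
  qed
qed

lemma complex_abs_continuous_density:
  fixes f :: "real \<Rightarrow> complex"
  assumes ac: "locally_abs_continuous_on f {0..}" and bv: "bounded_variation_on f {0..}"
  obtains g where "integrable lborel g" "\<And>x. x \<le> 0 \<Longrightarrow> g x = 0"
    "\<And>a b. \<lbrakk>0 \<le> a; a \<le> b\<rbrakk> \<Longrightarrow> f b - f a = (LINT x:{a..b}|lborel. g x)"
proof -
  have ac': "abs_continuous_on f {0..N}" for N using ac by (auto simp: locally_abs_continuous_on_def)
  obtain h1 where h1: "integrable lborel h1"
    "\<And>a b. \<lbrakk>0 \<le> a; a \<le> b\<rbrakk> \<Longrightarrow> Re (f b) - Re (f a) = (LINT x|lborel. indicator {a..b} x * h1 x)"
    by (rule real_abs_continuous_density[OF ac' bv, of Re]) (auto simp flip: minus_complex.sel intro: abs_Re_le_cmod)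
  obtain h2 where h2: "integrable lborel h2"
    "\<And>a b. \<lbrakk>0 \<le> a; a \<le> b\<rbrakk> \<Longrightarrow> Im (f b) - Im (f a) = (LINT x|lborel. indicator {a..b} x * h2 x)"
    by (rule real_abs_continuous_density[OF ac' bv, of Im]) (auto simp flip: minus_complex.sel intro: abs_Im_le_cmod)
  define g0 where "g0 x = complex_of_real (h1 x) + \<i> * complex_of_real (h2 x)" for x
  \<comment> \<open>On the closed half-line this changes \<open>g0\<close> at the single point 0; in
    return, later integrals over the half-line can be written over the whole line.\<close>
  define g where "g x = indicator {0<..} x *\<^sub>R g0 x" for x
  have g0: "integrable lborel g0"
    using h1(1) h2(1) unfolding g0_def
    by (intro Bochner_Integration.integrable_add integrable_mult_right integrable_of_real)
  show thesis
  proof (rule that)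
    show "integrable lborel g" unfolding g_def using g0 by (intro integrable_mult_indicator) auto
    show "g x = 0" if "x \<le> 0" for x using that by (simp add: g_def)
    fix a b :: real assume ab: "0 \<le> a" "a \<le> b"
    have i: "integrable lborel (\<lambda>x. indicator {a..b} x * h1 x)" "integrable lborel (\<lambda>x. indicator {a..b} x * h2 x)"
      by (intro integrable_indicator_Icc_mult h1(1) h2(1))+
    have "(LINT x:{a..b}|lborel. g x) = (LINT x|lborel. indicator {a..b} x *\<^sub>R g0 x)"
      unfolding set_lebesgue_integral_def
    proof (rule integral_cong_AE)
      show "AE x in lborel. indicator {a..b} x *\<^sub>R g x = indicator {a..b} x *\<^sub>R g0 x"
        using AE_lborel_singleton[of 0] by eventually_elim (use ab in \<open>auto simp: g_def split: split_indicator\<close>)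
    qed (use g0 in \<open>auto simp: g_def\<close>)
    also have "\<dots> = (LINT x|lborel. complex_of_real (indicator {a..b} x * h1 x) + \<i> * complex_of_real (indicator {a..b} x * h2 x))"
      by (rule Bochner_Integration.integral_cong) (auto simp: g0_def split: split_indicator)
    also have "\<dots> = complex_of_real (LINT x|lborel. indicator {a..b} x * h1 x) + \<i> * complex_of_real (LINT x|lborel. indicator {a..b} x * h2 x)"
      using i by (subst Bochner_Integration.integral_add) (auto simp: integral_complex_of_real simp del: of_real_mult)
    also have "\<dots> = f b - f a"
      using h1(2)[OF ab] h2(2)[OF ab] by (simp add: complex_eq_iff)
    finally show "f b - f a = (LINT x:{a..b}|lborel. g x)" ..
  qed
qed

subsection \<open>A rational modification of the sine integral\<close>

lemma norm_set_integral_le: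
  fixes f :: "'a \<Rightarrow> 'b::{banach, second_countable_topology}" and h :: "'a \<Rightarrow> real"
  assumes f: "set_integrable M S f" and h: "set_integrable M S h"
    and le: "\<And>x. x \<in> S \<Longrightarrow> norm (f x) \<le> h x"
  shows "norm (LINT x:S|M. f x) \<le> (LINT x:S|M. h x)"
  by (rule order_trans[OF set_integral_norm_bound[OF f] set_integral_mono[OF set_integrable_norm[OF f] h le]])

text \<open>This weight, with primitive \<open>2 * arctan (sqrt u)\<close>, is the majorant in two
  places: for the integrand of \<open>rat_Si\<close> in the variable \<open>u\<close>, and for
  \<open>\<bar>remainder_kernel s\<bar> / s\<close> in the variable \<open>s\<close>.\<close>

lemma sqrt_weight:
  shows set_integrable_sqrt_weight: "set_integrable lborel {0<..} (\<lambda>u. 1 / (sqrt u * (1 + u)))"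
    and LBINT_sqrt_weight: "(LBINT u:{0<..}. 1 / (sqrt u * (1 + u))) = pi"
proof -
  let ?q = "\<lambda>u::real. 1 / (sqrt u * (1 + u))" and ?F = "\<lambda>u. 2 * arctan (sqrt u)"
  have 1: "(?F has_real_derivative ?q u) (at u)" if "0 < ereal u" for u
    using that by (auto intro!: derivative_eq_intros simp: field_simps add_nonneg_eq_0_iff)
  have 2: "isCont ?q u" if "0 < ereal u" for u
    using that by (auto intro!: continuous_intros simp: add_nonneg_eq_0_iff)
  have 3: "((?F \<circ> real_of_ereal) \<longlongrightarrow> 0) (at_right 0)"
    unfolding zero_ereal_def ereal_tendsto_simps
    by (rule tendsto_eq_intros refl | simp)+
  have 4: "((?F \<circ> real_of_ereal) \<longlongrightarrow> pi) (at_left \<infinity>)"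
    unfolding ereal_tendsto_simps
    using tendsto_mult[OF tendsto_const[of 2] filterlim_compose[OF tendsto_arctan_at_top sqrt_at_top]] by simp
  have 5: "AE u in lborel. 0 < ereal u \<longrightarrow> ereal u < \<infinity> \<longrightarrow> 0 \<le> ?q u" by auto
  have "set_integrable lborel (einterval 0 \<infinity>) ?q" "(LBINT u=0..\<infinity>. ?q u) = pi - 0"
    by (rule interval_integral_FTC_nonneg[OF _ 1 2 5 3 4]; simp)+
  then show "set_integrable lborel {0<..} ?q" "(LBINT u:{0<..}. ?q u) = pi"
    by (simp_all add: interval_lebesgue_integral_def einterval_def zero_ereal_def greaterThan_def)
qed

text \<open>A compromise between the bounds \<open>y\<close> and 1: the power \<open>1/2\<close>
  tames the pole of \<open>1 / (u * (u + 1))\<close> at 0 enough for integrability, and still leaves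
  a positive power of \<open>s\<close>.\<close>

lemma abs_sin_le_sqrt: "0 \<le> y \<Longrightarrow> \<bar>sin y\<bar> \<le> sqrt y"
proof -
  assume "0 \<le> (y::real)"
  show ?thesis
  proof (cases "y \<le> 1")
    case True
    have "\<bar>sin y\<bar> \<le> y" using abs_sin_x_le_abs_x[of y] \<open>0 \<le> y\<close> by simp
    also have "y \<le> sqrt y" using True \<open>0 \<le> y\<close>
      by (intro real_le_rsqrt) (simp add: power2_eq_square mult_left_le)
    finally show ?thesis .
  next
    case False
    then have "1 \<le> sqrt y" by simp
    then show ?thesis using abs_sin_le_one[of y] by linarith
  qed
qed

text \<open>The function \<open>J\<close> of the overview. The closed half-line fits the truncations
  to \<open>{0..A}\<close>; at \<open>u = 0\<close> the integrand is 0 by division by zero.\<close>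

definition rat_Si :: "real \<Rightarrow> real" where
  "rat_Si s = (LBINT u:{0..}. sin (u * s) / (u * (u + 1)))"

lemma rat_Si_integrand_le:
  assumes "0 < u" "0 \<le> s"
  shows "\<bar>sin (u * s) / (u * (u + 1))\<bar> \<le> sqrt s * (1 / (sqrt u * (1 + u)))"
proof -
  have "\<bar>sin (u * s) / (u * (u + 1))\<bar> = \<bar>sin (u * s)\<bar> / (u * (u + 1))" using assms by (simp add: abs_mult)
  also have "\<dots> \<le> sqrt (u * s) / (u * (u + 1))"
    using assms by (intro divide_right_mono abs_sin_le_sqrt) auto
  also have "\<dots> = sqrt s * sqrt u / (sqrt u * sqrt u * (u + 1))" using assms by (simp add: real_sqrt_mult)
  also have "\<dots> = sqrt s * (1 / (sqrt u * (1 + u)))"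
  proof -
    have "sqrt u > 0" "u + 1 > 0" using assms by auto
    then show ?thesis by (simp add: divide_simps del: real_sqrt_mult_self)
  qed
  finally show ?thesis .
qed

lemma rat_Si_integrable:
  fixes s :: real
  assumes "0 \<le> s"
  shows "set_integrable lborel {0..} (\<lambda>u. sin (u * s) / (u * (u + 1)))"
    and "set_integrable lborel {0<..} (\<lambda>u. sin (u * s) / (u * (u + 1)))"
proof -
  let ?f = "\<lambda>u. sin (u * s) / (u * (u + 1))"
  show i: "set_integrable lborel {0<..} ?f"
  proof (rule set_integrable_bound)
    show "set_integrable lborel {0<..} (\<lambda>u. sqrt s * (1 / (sqrt u * (1 + u))))"
      using set_integrable_sqrt_weight by (intro set_integrable_mult_right)
    show "set_borel_measurable lborel {0<..} ?f" unfolding set_borel_measurable_def by measurable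
    show "AE u in lborel. u \<in> {0<..} \<longrightarrow> norm (?f u) \<le> norm (sqrt s * (1 / (sqrt u * (1 + u))))"
    proof (intro AE_I2 impI)
      fix u :: real assume "u \<in> {0<..}"
      then show "norm (?f u) \<le> norm (sqrt s * (1 / (sqrt u * (1 + u))))"
        using rat_Si_integrand_le[of u s] assms by (simp add: abs_mult)
    qed
  qed
  have "(\<lambda>u. indicator {0..} u *\<^sub>R ?f u) = (\<lambda>u. indicator {0<..} u *\<^sub>R ?f u)"
    by (auto simp: fun_eq_iff split: split_indicator)
  with i show "set_integrable lborel {0..} ?f" unfolding set_integrable_def by simp
qed

lemma rat_Si_alt: "rat_Si s = (LBINT u:{0<..}. sin (u * s) / (u * (u + 1)))"
  unfolding rat_Si_def set_lebesgue_integral_def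
  by (rule Bochner_Integration.integral_cong) (auto split: split_indicator)

lemma abs_rat_Si_le_sqrt:
  assumes "0 \<le> s"
  shows "\<bar>rat_Si s\<bar> \<le> pi * sqrt s"
proof -
  have "\<bar>rat_Si s\<bar> \<le> (LBINT u:{0<..}. sqrt s * (1 / (sqrt u * (1 + u))))"
    unfolding rat_Si_alt real_norm_def[symmetric]
    by (rule norm_set_integral_le[OF rat_Si_integrable(2)[OF assms] set_integrable_mult_right])
      (use rat_Si_integrand_le[of _ s] assms set_integrable_sqrt_weight in auto)
  also have "\<dots> = pi * sqrt s" by (subst set_integral_mult_right) (simp add: LBINT_sqrt_weight)
  finally show ?thesis .
qed

text \<open>The case distinction is the removable singularity of \<open>sin y / y\<close>, whose
  value 1 at 0 becomes \<open>h' * s\<close> under the chain rule.\<close>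

lemma DERIV_Si_scaled:
  assumes "s > 0" "\<And>u. (h has_real_derivative h') (at u)"
  shows "((\<lambda>u. Si (h u * s)) has_real_derivative (if h u = 0 then h' * s else h' * (sin (h u * s) / h u))) (at u)"
proof -
  have "((\<lambda>u. Si (h u * s)) has_real_derivative (if h u * s = 0 then 1 else sin (h u * s) / (h u * s)) * (h' * s)) (at u)"
    by (rule DERIV_chain2[OF DERIV_Si]) (auto intro!: derivative_eq_intros assms)
  moreover have "(if h u * s = 0 then 1 else sin (h u * s) / (h u * s)) * (h' * s) =
      (if h u = 0 then h' * s else h' * (sin (h u * s) / h u))"
    using assms by auto
  ultimately show ?thesis by (rule DERIV_cong)
qed

text \<open>Since \<open>1 / (u * (u + 1)) = 1 / u - 1 / (u + 1)\<close>, the first part integrates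
  to \<open>Si (A * s)\<close>, and an integration by parts makes the second one of order
  \<open>1 / s\<close>, uniformly in \<open>A\<close>.\<close>

lemma rat_Si_truncated_bound:
  assumes s: "s > 0" and A: "A \<ge> 0"
  shows "\<bar>(LBINT u:{0..A}. sin (u * s) / (u * (u + 1))) - Si (A * s)\<bar> \<le> 2 / s"
proof -
  let ?f = "\<lambda>u. sin (u * s) / (u * (u + 1))"
  have si: "((\<lambda>u. if u = 0 then s else sin (u * s) / u) has_integral (Si (A * s) - Si (0 * s))) {0..A}"
  proof (rule fundamental_theorem_of_calculus[OF A])
    fix u :: real
    have "((\<lambda>u. Si (u * s)) has_real_derivative (if u = 0 then s else sin (u * s) / u)) (at u)"
      by (rule DERIV_cong[OF DERIV_Si_scaled[OF s DERIV_ident]]) simp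
    then show "((\<lambda>u. Si (u * s)) has_vector_derivative (if u = 0 then s else sin (u * s) / u)) (at u within {0..A})"
      unfolding has_real_derivative_iff_has_vector_derivative by (rule has_vector_derivative_at_within)
  qed
  have parts: "((\<lambda>u. sin (u * s) / (u + 1) + cos (u * s) / (s * (u + 1)^2)) has_integral
      (- cos (A * s) / (s * (A + 1)) - (- cos (0 * s) / (s * (0 + 1))))) {0..A}"
  proof (rule fundamental_theorem_of_calculus[OF A])
    fix u assume "u \<in> {0..A}"
    then have "((\<lambda>u. - cos (u * s) / (s * (u + 1))) has_real_derivative
        sin (u * s) / (u + 1) + cos (u * s) / (s * (u + 1)^2)) (at u within {0..A})"
      using s by (auto intro!: derivative_eq_intros simp: field_simps power2_eq_square add_nonneg_eq_0_iff)
    then show "((\<lambda>u. - cos (u * s) / (s * (u + 1))) has_vector_derivative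
        sin (u * s) / (u + 1) + cos (u * s) / (s * (u + 1)^2)) (at u within {0..A})"
      by (simp add: has_real_derivative_iff_has_vector_derivative)
  qed
  have dom: "((\<lambda>u. 1 / (s * (u + 1)^2)) has_integral (- 1 / (s * (A + 1)) - (- 1 / (s * (0 + 1))))) {0..A}"
  proof (rule fundamental_theorem_of_calculus[OF A])
    fix u assume "u \<in> {0..A}"
    then have "((\<lambda>u. - 1 / (s * (u + 1))) has_real_derivative 1 / (s * (u + 1)^2)) (at u within {0..A})"
      using s by (auto intro!: derivative_eq_intros simp: field_simps power2_eq_square add_nonneg_eq_0_iff)
    then show "((\<lambda>u. - 1 / (s * (u + 1))) has_vector_derivative 1 / (s * (u + 1)^2)) (at u within {0..A})"
      by (simp add: has_real_derivative_iff_has_vector_derivative)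
  qed
  have cint: "(\<lambda>u. cos (u * s) / (s * (u + 1)^2)) integrable_on {0..A}"
    by (rule integrable_continuous_real) (use s in \<open>auto intro!: continuous_intros simp: add_nonneg_eq_0_iff\<close>)
  let ?c = "integral {0..A} (\<lambda>u. cos (u * s) / (s * (u + 1)^2))"
  \<comment> \<open>The exact value of the dominating integral is kept: its negative part
    compensates the boundary term at \<open>A\<close>, so that the total is
    \<open>2 / s\<close>.\<close>
  have c_le: "\<bar>?c\<bar> \<le> 1 / s - 1 / (s * (A + 1))"
  proof -
    have "norm ?c \<le> integral {0..A} (\<lambda>u. 1 / (s * (u + 1)^2))"
    proof (rule integral_norm_bound_integral[OF cint has_integral_integrable[OF dom]])
      fix u assume "u \<in> {0..A}"
      then show "norm (cos (u * s) / (s * (u + 1)^2)) \<le> 1 / (s * (u + 1)^2)"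
        using s by (simp add: abs_mult divide_right_mono)
    qed
    then show ?thesis using integral_unique[OF dom] by simp
  qed
  define I where "I = (- cos (A * s) / (s * (A + 1)) - (- cos (0 * s) / (s * (0 + 1)))) - ?c"
  have sin1: "((\<lambda>u. sin (u * s) / (u + 1)) has_integral I) {0..A}"
    using has_integral_diff[OF parts integrable_integral[OF cint]] unfolding I_def by simp
  have I_le: "\<bar>I\<bar> \<le> 2 / s"
  proof -
    have "\<bar>cos (A * s) / (s * (A + 1))\<bar> \<le> 1 / (s * (A + 1))"
      using s A by (simp add: abs_mult divide_right_mono)
    moreover have "I = 1 / s - cos (A * s) / (s * (A + 1)) - ?c" unfolding I_def by simp
    moreover have "2 / s = 1 / s + 1 / s" by simp
    ultimately show ?thesis using c_le by linarith
  qed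
  have "((\<lambda>u. (if u = 0 then s else sin (u * s) / u) - sin (u * s) / (u + 1)) has_integral (Si (A * s) - Si (0 * s) - I)) {0..A}"
    by (rule has_integral_diff[OF si sin1])
  then have "(?f has_integral (Si (A * s) - Si (0 * s) - I)) {0..A}"
  proof (rule has_integral_spike_finite[rotated 2, of _ _ _ "{0}"])
    fix u assume "u \<in> {0..A} - {0}"
    then show "?f u = (if u = 0 then s else sin (u * s) / u) - sin (u * s) / (u + 1)"
      by (simp add: field_simps)
  qed auto
  moreover have "set_integrable lborel {0..A} ?f"
    by (rule set_integrable_subset[OF rat_Si_integrable(1)]) (use s in auto)
  ultimately have "(LBINT u:{0..A}. ?f u) = Si (A * s) - I"
    using Si_neg[of 0] by (simp add: set_borel_integral_eq_integral integral_unique)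
  then show ?thesis using I_le by simp
qed

lemma abs_rat_Si_diff_le:
  assumes s: "s > 0"
  shows "\<bar>rat_Si s - pi / 2\<bar> \<le> 2 / s"
proof -
  have 1: "((\<lambda>A. LBINT u:{0..A}. sin (u * s) / (u * (u + 1))) \<longlongrightarrow> rat_Si s) at_top"
    unfolding rat_Si_def by (rule tendsto_set_lebesgue_integral_at_top) (use rat_Si_integrable(1)[of s] s in auto)
  have 2: "((\<lambda>A. Si (A * s)) \<longlongrightarrow> pi / 2) at_top"
    by (rule filterlim_compose[OF Si_at_top]) (use s in \<open>auto intro!: filterlim_at_top_mult_tendsto_pos filterlim_ident\<close>)
  have "\<forall>\<^sub>F A in at_top. norm ((LBINT u:{0..A}. sin (u * s) / (u * (u + 1))) - Si (A * s)) \<le> 2 / s"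
    using eventually_ge_at_top[of 0] by eventually_elim (use rat_Si_truncated_bound[OF s] in auto)
  then show ?thesis
    using Lim_norm_ubound[OF _ tendsto_diff[OF 1 2], of "2 / s"] by simp
qed

lemma bounded_rat_Si: "\<exists>B. \<forall>s>0. \<bar>rat_Si s\<bar> \<le> B"
proof (intro exI allI impI)
  fix s :: real assume s: "s > 0"
  show "\<bar>rat_Si s\<bar> \<le> pi + 2"
  proof (cases "s \<le> 1")
    case True
    then have "pi * sqrt s \<le> pi" using s by (simp add: mult_left_le)
    then show ?thesis using abs_rat_Si_le_sqrt[of s] s by linarith
  next
    case False
    then have "2 / s \<le> 2" by (simp add: field_simps)
    then show ?thesis using abs_rat_Si_diff_le[OF s] pi_gt_zero by linarith
  qed
qed

subsection \<open>The principal value integral\<close>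

text \<open>For positive \<open>s\<close> and \<open>v\<close> this is
  \<open>Ci (v * s) - Ci s\<close> with the cosine integral \<open>Ci\<close>. The base point 1
  avoids the logarithmic singularity at 0 and any improper integral; only differences of values
  enter.\<close>

definition Ci_prim :: "real \<Rightarrow> real \<Rightarrow> real" where
  "Ci_prim s v = (LBINT y=1..v. cos (y * s) / y)"

lemma DERIV_Ci_prim:
  assumes "v > 0"
  shows "(Ci_prim s has_real_derivative cos (v * s) / v) (at v)"
proof -
  let ?a = "min 1 v / 2" and ?b = "max 1 v + 1"
  have "((\<lambda>u. LBINT y=1..u. cos (y * s) / y) has_vector_derivative cos (v * s) / v) (at v within {?a..?b})"
    unfolding one_ereal_def
    by (rule interval_integral_FTC2) (use assms in \<open>auto intro!: continuous_intros simp: min_def max_def split: if_splits\<close>)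
  moreover have "at v within {?a..?b} = at v"
    by (rule at_within_interior) (use assms in \<open>auto simp: min_def max_def\<close>)
  ultimately show ?thesis
    unfolding has_real_derivative_iff_has_vector_derivative Ci_prim_def[abs_def] by metis
qed

text \<open>A crude bound that suffices in both uses: with the fixed gap 2 as \<open>a\<close> tends
  to infinity, and with the gap \<open>2 * \<delta>\<close> around the point 2.\<close>

lemma Ci_prim_diff_le:
  assumes "0 < a" "a < b"
  shows "\<bar>Ci_prim s b - Ci_prim s a\<bar> \<le> (b - a) / a"
proof -
  obtain z where z: "a < z" "z < b" "Ci_prim s b - Ci_prim s a = (b - a) * (cos (z * s) / z)"
    using MVT2[OF assms(2), of "Ci_prim s" "\<lambda>v. cos (v * s) / v"] assms DERIV_Ci_prim by auto
  have "\<bar>cos (z * s) / z\<bar> \<le> 1 / a"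
    using z assms by (auto simp: abs_mult intro!: frac_le)
  then have "(b - a) * \<bar>cos (z * s) / z\<bar> \<le> (b - a) * (1 / a)"
    using assms by (intro mult_left_mono) auto
  then show ?thesis using z assms by (simp add: abs_mult)
qed

text \<open>The partial fractions are \<open>- 1 / u + (1 / (u - 1) + 1 / (u + 1)) / 2\<close>. The
  addition theorem then shifts the argument of the sine to match each denominator, so that every
  summand has a primitive in terms of \<open>Si\<close> or \<open>Ci_prim\<close>.\<close>

lemma sin_partial_fractions:
  fixes u s :: real
  assumes "u \<noteq> 0" "u \<noteq> 1" "u \<noteq> - 1"
  shows "sin (u * s) / (u * (u\<^sup>2 - 1)) = - (sin (u * s) / u) +
     (cos s * (sin ((u - 1) * s) / (u - 1) + sin ((u + 1) * s) / (u + 1)) +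
      sin s * (cos ((u - 1) * s) / (u - 1) - cos ((u + 1) * s) / (u + 1))) / 2"
proof -
  have 1: "sin (u * s) = sin ((u - 1) * s) * cos s + cos ((u - 1) * s) * sin s"
    using sin_add[of "(u - 1) * s" s] by (simp add: algebra_simps)
  have 2: "sin (u * s) = sin ((u + 1) * s) * cos s - cos ((u + 1) * s) * sin s"
    using sin_diff[of "(u + 1) * s" s] by (simp add: algebra_simps)
  have "sin (u * s) / (u * (u\<^sup>2 - 1)) = - (sin (u * s) / u) + (sin (u * s) / (u - 1) + sin (u * s) / (u + 1)) / 2"
  proof -
    have "u\<^sup>2 - 1 = (u - 1) * (u + 1)" by (simp add: algebra_simps power2_eq_square)
    moreover have "u - 1 \<noteq> 0" "u + 1 \<noteq> 0" using assms by auto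
    ultimately show ?thesis using assms(1) by (simp add: divide_simps) (simp add: algebra_simps)
  qed
  also have "sin (u * s) / (u - 1) = cos s * (sin ((u - 1) * s) / (u - 1)) + sin s * (cos ((u - 1) * s) / (u - 1))"
    unfolding 1 by (simp add: add_divide_distrib mult.commute)
  also have "sin (u * s) / (u + 1) = cos s * (sin ((u + 1) * s) / (u + 1)) - sin s * (cos ((u + 1) * s) / (u + 1))"
    unfolding 2 by (simp add: diff_divide_distrib mult.commute)
  finally show ?thesis by (simp add: algebra_simps)
qed

text \<open>
  Partial fractions and the addition theorem give this primitive; the logarithmic singularity of
  \<open>Ci_prim\<close> cancels in \<open>pv_prim s (1 - \<delta>) - pv_prim s (1 + \<delta>)\<close>.
\<close>

definition pv_prim :: "real \<Rightarrow> real \<Rightarrow> real" where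
  "pv_prim s u = - Si (u * s) +
     (cos s * (Si ((u - 1) * s) + Si ((u + 1) * s)) + sin s * (Ci_prim s \<bar>u - 1\<bar> - Ci_prim s (u + 1))) / 2"

text \<open>For \<open>u < 1\<close> the sign of the inner derivative is absorbed, because the
  cosine is even and the denominator odd; hence one formula on both sides of 1.\<close>

lemma DERIV_Ci_prim_abs:
  assumes "u \<noteq> 1"
  shows "((\<lambda>u. Ci_prim s \<bar>u - 1\<bar>) has_real_derivative cos ((u - 1) * s) / (u - 1)) (at u)"
proof (cases "u < 1")
  case True
  have "((\<lambda>u. Ci_prim s (1 - u)) has_real_derivative cos ((1 - u) * s) / (1 - u) * (- 1)) (at u)"
    by (rule DERIV_chain2[OF DERIV_Ci_prim]) (use True in \<open>auto intro!: derivative_eq_intros\<close>)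
  moreover have "cos ((1 - u) * s) / (1 - u) * (- 1) = cos ((u - 1) * s) / (u - 1)"
  proof -
    have "cos ((1 - u) * s) = cos ((u - 1) * s)"
      using cos_minus[of "(u - 1) * s"] by (simp add: algebra_simps)
    then show ?thesis by (simp add: minus_divide_right)
  qed
  ultimately have "((\<lambda>u. Ci_prim s (1 - u)) has_real_derivative cos ((u - 1) * s) / (u - 1)) (at u)" by (simp only:)
  then show ?thesis
    by (rule has_field_derivative_transform_within_open[of _ _ _ "{..<1}"]) (use True in auto)
next
  case False
  have "((\<lambda>u. Ci_prim s (u - 1)) has_real_derivative cos ((u - 1) * s) / (u - 1) * 1) (at u)"
    by (rule DERIV_chain2[OF DERIV_Ci_prim]) (use False assms in \<open>auto intro!: derivative_eq_intros\<close>)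
  then have "((\<lambda>u. Ci_prim s (u - 1)) has_real_derivative cos ((u - 1) * s) / (u - 1)) (at u)" by simp
  then show ?thesis
    by (rule has_field_derivative_transform_within_open[of _ _ _ "{1<..}"]) (use False assms in auto)
qed

lemma DERIV_pv_prim:
  assumes "s > 0" "0 < u" "u \<noteq> 1"
  shows "(pv_prim s has_real_derivative sin (u * s) / (u * (u\<^sup>2 - 1))) (at u)"
proof -
  have 1: "((\<lambda>u. Si (u * s)) has_real_derivative sin (u * s) / u) (at u)"
    by (rule DERIV_cong[OF DERIV_Si_scaled[OF assms(1) DERIV_ident]]) (use assms in simp)
  have 2: "((\<lambda>u. Si ((u - 1) * s)) has_real_derivative sin ((u - 1) * s) / (u - 1)) (at u)"
    by (rule DERIV_cong[OF DERIV_Si_scaled[OF assms(1), of "\<lambda>u. u - 1" 1]])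
       (use assms in \<open>auto intro!: derivative_eq_intros\<close>)
  have 3: "((\<lambda>u. Si ((u + 1) * s)) has_real_derivative sin ((u + 1) * s) / (u + 1)) (at u)"
    by (rule DERIV_cong[OF DERIV_Si_scaled[OF assms(1), of "\<lambda>u. u + 1" 1]])
       (use assms in \<open>auto intro!: derivative_eq_intros\<close>)
  have 4: "((\<lambda>u. Ci_prim s (u + 1)) has_real_derivative cos ((u + 1) * s) / (u + 1) * 1) (at u)"
    by (rule DERIV_chain2[OF DERIV_Ci_prim]) (use assms in \<open>auto intro!: derivative_eq_intros\<close>)
  have 5: "((\<lambda>u. Ci_prim s \<bar>u - 1\<bar>) has_real_derivative cos ((u - 1) * s) / (u - 1)) (at u)"
    by (rule DERIV_Ci_prim_abs) (use assms in auto)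
  have pf: "sin (u * s) / (u * (u\<^sup>2 - 1)) = - (sin (u * s) / u) +
     (cos s * (sin ((u - 1) * s) / (u - 1) + sin ((u + 1) * s) / (u + 1)) +
      sin s * (cos ((u - 1) * s) / (u - 1) - cos ((u + 1) * s) / (u + 1) * 1)) / 2"
    using sin_partial_fractions[of u s] assms by simp
  show ?thesis
    unfolding pf pv_prim_def[abs_def]
    by (intro DERIV_add DERIV_minus DERIV_cdivide DERIV_cmult DERIV_diff 1 2 3 4 5)
qed

text \<open>The point 0 is included here but not in the derivative: the integrand is 0 there by
  division by zero, whereas its limit is \<open>- s\<close>. Continuity at the endpoint is enough
  for the fundamental theorem.\<close>

lemma isCont_pv_prim:
  assumes "0 \<le> u" "u \<noteq> 1"
  shows "isCont (pv_prim s) u"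
proof -
  have Si: "isCont (\<lambda>u. Si (h u)) u" if "isCont h u" for h :: "real \<Rightarrow> real" and u
    by (rule isCont_o2[OF that isCont_Si])
  have "isCont (\<lambda>u. Ci_prim s (u + 1)) u"
    by (rule isCont_o2[of u "\<lambda>u. u + 1", OF _ DERIV_isCont[OF DERIV_Ci_prim]]) (use assms in auto)
  moreover have "isCont (\<lambda>u. Ci_prim s \<bar>u - 1\<bar>) u"
    by (rule DERIV_isCont[OF DERIV_Ci_prim_abs[OF assms(2)]])
  ultimately show ?thesis
    unfolding pv_prim_def[abs_def] by (intro continuous_intros Si) auto
qed

lemma has_integral_pv_prim:
  assumes "s > 0" "0 \<le> a" "a \<le> b" "1 \<notin> {a..b}"
  shows "((\<lambda>u. sin (u * s) / (u * (u\<^sup>2 - 1))) has_integral (pv_prim s b - pv_prim s a)) {a..b}"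
proof (rule fundamental_theorem_of_calculus_interior)
  show "continuous_on {a..b} (pv_prim s)"
  proof (rule continuous_at_imp_continuous_on, rule ballI)
    fix u assume "u \<in> {a..b}"
    then show "isCont (pv_prim s) u" using assms by (intro isCont_pv_prim) auto
  qed
  fix u assume "u \<in> {a<..<b}"
  then have "(pv_prim s has_real_derivative sin (u * s) / (u * (u\<^sup>2 - 1))) (at u)"
    using assms by (intro DERIV_pv_prim) auto
  then show "(pv_prim s has_vector_derivative sin (u * s) / (u * (u\<^sup>2 - 1))) (at u)"
    unfolding has_real_derivative_iff_has_vector_derivative .
qed (use assms in auto)

section \<open>Integrability of the kernel off the singularity\<close>

lemma set_integrable_inverse_square_shift:
  assumes "x > 0"
  shows "set_integrable lborel {0..} (\<lambda>u::real. 1 / (u + x)\<^sup>2)"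
proof -
  let ?F = "\<lambda>u. - 1 / (u + x)"
  \<comment> \<open>Starting at \<open>- x / 2\<close> keeps a distance from the pole
    \<open>- x\<close> and puts the closed half-line inside the open interval of
    integration.\<close>
  have 1: "(?F has_real_derivative 1 / (u + x)\<^sup>2) (at u)" if "ereal (- x / 2) < ereal u" for u
    using that assms by (auto intro!: derivative_eq_intros simp: field_simps power2_eq_square)
  have 2: "isCont (\<lambda>u. 1 / (u + x)\<^sup>2) u" if "ereal (- x / 2) < ereal u" for u
    using that assms by (auto intro!: continuous_intros)
  have 3: "((?F \<circ> real_of_ereal) \<longlongrightarrow> - 1 / (- x / 2 + x)) (at_right (ereal (- x / 2)))"
    unfolding ereal_tendsto_simps by (rule tendsto_intros | use assms in simp)+
  have "filterlim (\<lambda>u. u + x) at_top at_top"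
    using filterlim_tendsto_add_at_top[OF tendsto_const filterlim_ident, of x] by (simp add: add.commute)
  from real_tendsto_divide_at_top[OF tendsto_const this]
  have 4: "((?F \<circ> real_of_ereal) \<longlongrightarrow> 0) (at_left \<infinity>)"
    unfolding ereal_tendsto_simps by blast
  have "set_integrable lborel (einterval (ereal (- x / 2)) \<infinity>) (\<lambda>u. 1 / (u + x)\<^sup>2)"
    by (rule interval_integral_FTC_nonneg(1)[OF _ 1 2 _ 3 4]) auto
  then show ?thesis
    by (rule set_integrable_subset) (use assms in \<open>auto simp: einterval_def\<close>)
qed

text \<open>\<open>u + x\<close> is at most \<open>\<bar>u - x\<bar> + 2 * x\<close>, and outside
  the window \<open>2 * x\<close> is at most \<open>2 * x / \<delta>\<close> times
  \<open>\<bar>u - x\<bar>\<close>; so the factor \<open>\<bar>u - x\<bar>\<close> can be traded for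
  \<open>u + x\<close>.\<close>

lemma abs_inverse_diff_squares_le:
  fixes u x \<delta> :: real
  assumes "0 \<le> u" "x > 0" "\<delta> > 0" "\<delta> \<le> \<bar>u - x\<bar>"
  shows "\<bar>1 / (u\<^sup>2 - x\<^sup>2)\<bar> \<le> (1 + 2 * x / \<delta>) * (1 / (u + x)\<^sup>2)"
proof -
  have "2 * x \<le> 2 * x * (\<bar>u - x\<bar> / \<delta>)"
    using assms by (intro mult_le_cancel_left1[THEN iffD2]) (auto simp: field_simps)
  then have "u + x \<le> \<bar>u - x\<bar> + 2 * x / \<delta> * \<bar>u - x\<bar>" by (auto simp: abs_if split: if_splits)
  then have le: "u + x \<le> (1 + 2 * x / \<delta>) * \<bar>u - x\<bar>" by (simp add: algebra_simps)
  have pos: "u + x > 0" "\<bar>u - x\<bar> > 0" using assms by auto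
  have "\<bar>1 / (u\<^sup>2 - x\<^sup>2)\<bar> = 1 / (\<bar>u - x\<bar> * (u + x))"
  proof -
    have "u\<^sup>2 - x\<^sup>2 = (u - x) * (u + x)" by (simp add: algebra_simps power2_eq_square)
    then show ?thesis using pos by (simp add: abs_mult)
  qed
  also have "\<dots> \<le> (1 + 2 * x / \<delta>) * (1 / (u + x)\<^sup>2)"
    using pos le by (simp add: divide_simps power2_eq_square)
  finally show ?thesis .
qed

lemma set_integrable_inverse_diff_squares:
  fixes x \<delta> :: real
  assumes "x > 0" "\<delta> > 0"
  shows "set_integrable lborel {u. 0 \<le> u \<and> \<delta> \<le> \<bar>u - x\<bar>} (\<lambda>u. 1 / (u\<^sup>2 - x\<^sup>2))"
proof (rule set_integrable_bound)
  have "set_integrable lborel {0..} (\<lambda>u. (1 + 2 * x / \<delta>) * (1 / (u + x)\<^sup>2))"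
    using set_integrable_inverse_square_shift[OF assms(1)] by (intro set_integrable_mult_right)
  then show "set_integrable lborel {u. 0 \<le> u \<and> \<delta> \<le> \<bar>u - x\<bar>} (\<lambda>u. (1 + 2 * x / \<delta>) * (1 / (u + x)\<^sup>2))"
    by (rule set_integrable_subset) auto
  show "set_borel_measurable lborel {u. 0 \<le> u \<and> \<delta> \<le> \<bar>u - x\<bar>} (\<lambda>u. 1 / (u\<^sup>2 - x\<^sup>2))"
    unfolding set_borel_measurable_def by measurable
  show "AE u in lborel. u \<in> {u. 0 \<le> u \<and> \<delta> \<le> \<bar>u - x\<bar>} \<longrightarrow>
      norm (1 / (u\<^sup>2 - x\<^sup>2)) \<le> norm ((1 + 2 * x / \<delta>) * (1 / (u + x)\<^sup>2))"
  proof (intro AE_I2 impI)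
    fix u assume "u \<in> {u. 0 \<le> u \<and> \<delta> \<le> \<bar>u - x\<bar>}"
    then show "norm (1 / (u\<^sup>2 - x\<^sup>2)) \<le> norm ((1 + 2 * x / \<delta>) * (1 / (u + x)\<^sup>2))"
      using abs_inverse_diff_squares_le[of u x \<delta>] assms by (simp add: abs_mult)
  qed
qed

lemma set_integrable_sin_kernel:
  fixes x \<delta> t :: real
  assumes "x > 0" "\<delta> > 0"
  shows "set_integrable lborel {u. 0 \<le> u \<and> \<delta> \<le> \<bar>u - x\<bar>} (\<lambda>u. sin (u * t) / (u\<^sup>2 - x\<^sup>2))"
proof (rule set_integrable_bound[OF set_integrable_inverse_diff_squares[OF assms]])
  show "set_borel_measurable lborel {u. 0 \<le> u \<and> \<delta> \<le> \<bar>u - x\<bar>} (\<lambda>u. sin (u * t) / (u\<^sup>2 - x\<^sup>2))"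
    unfolding set_borel_measurable_def by measurable
qed (auto simp: divide_right_mono)

lemma pv_prim_0 [simp]:
  assumes "s > 0" shows "pv_prim s 0 = 0"
  using Si_neg[of 0] Si_neg[of s] assms by (simp add: pv_prim_def)

text \<open>As \<open>pv_prim s 0 = 0\<close>, this limit is the whole principal value integral once
  the jump across 1 is known to vanish. The three \<open>Si\<close> terms tend to
  \<open>pi / 2\<close> with weights \<open>- 1\<close>, \<open>cos s / 2\<close> and
  \<open>cos s / 2\<close>.\<close>

lemma tendsto_pv_prim_at_top:
  assumes s: "s > 0"
  shows "(pv_prim s \<longlongrightarrow> pi / 2 * (cos s - 1)) at_top"
proof -
  have lin: "filterlim (\<lambda>u. (u + c) * s) at_top at_top" for c
    by (intro filterlim_at_top_mult_tendsto_pos[OF tendsto_const s] filterlim_tendsto_add_at_top[OF tendsto_const filterlim_ident, of c, simplified add.commute])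
  have Si: "((\<lambda>u. Si ((u + c) * s)) \<longlongrightarrow> pi / 2) at_top" for c
    by (rule filterlim_compose[OF Si_at_top lin])
  have Ci: "((\<lambda>u. Ci_prim s \<bar>u - 1\<bar> - Ci_prim s (u + 1)) \<longlongrightarrow> 0) at_top"
  proof (rule Lim_null_comparison)
    show "\<forall>\<^sub>F u in at_top. norm (Ci_prim s \<bar>u - 1\<bar> - Ci_prim s (u + 1)) \<le> 2 / (u + (- 1))"
      using eventually_gt_at_top[of 1]
    proof eventually_elim
      case (elim u)
      then show ?case using Ci_prim_diff_le[of "u - 1" "u + 1" s] by (simp add: abs_minus_commute)
    qed
    have "filterlim (\<lambda>u::real. u + (- 1)) at_top at_top"
      using filterlim_tendsto_add_at_top[OF tendsto_const filterlim_ident, of "- 1 :: real"] by (simp add: add.commute)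
    then show "((\<lambda>u::real. 2 / (u + (- 1))) \<longlongrightarrow> 0) at_top"
      by (rule real_tendsto_divide_at_top[OF tendsto_const])
  qed
  have "(pv_prim s \<longlongrightarrow> - (pi / 2) + (cos s * (pi / 2 + pi / 2) + sin s * 0) / 2) at_top"
    unfolding pv_prim_def[abs_def]
    by (intro tendsto_add tendsto_minus tendsto_divide tendsto_mult tendsto_const Ci
        Si[of 0, simplified] Si[of 1] Si[of "- 1", simplified]) auto
  also have "- (pi / 2) + (cos s * (pi / 2 + pi / 2) + sin s * 0) / 2 = pi / 2 * (cos s - 1)"
    by (simp add: algebra_simps)
  finally show ?thesis .
qed

text \<open>Both points have distance \<open>\<delta>\<close> from 1, so the singular values of
  \<open>Ci_prim\<close> cancel exactly and only those near 2 remain. The \<open>Si\<close> terms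
  stay explicit because they are bounded uniformly in \<open>s\<close> but tend to 0 only for fixed
  \<open>s\<close>.\<close>

lemma pv_prim_jump:
  assumes s: "s > 0" and \<delta>: "0 < \<delta>" "\<delta> < 1"
  shows "\<bar>pv_prim s (1 - \<delta>) - pv_prim s (1 + \<delta>) - ((Si ((1 + \<delta>) * s) - Si ((1 - \<delta>) * s)) +
     cos s * (Si ((2 - \<delta>) * s) - Si ((2 + \<delta>) * s) - 2 * Si (\<delta> * s)) / 2)\<bar> \<le> \<delta>"
proof -
  have neg: "Si (- \<delta> * s) = - Si (\<delta> * s)" using Si_neg[of "\<delta> * s"] s \<delta> by simp
  have "pv_prim s (1 - \<delta>) - pv_prim s (1 + \<delta>) - ((Si ((1 + \<delta>) * s) - Si ((1 - \<delta>) * s)) +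
     cos s * (Si ((2 - \<delta>) * s) - Si ((2 + \<delta>) * s) - 2 * Si (\<delta> * s)) / 2) =
     sin s * (Ci_prim s (2 + \<delta>) - Ci_prim s (2 - \<delta>)) / 2"
    unfolding pv_prim_def using neg \<delta> by (simp add: algebra_simps add_divide_distrib diff_divide_distrib)
  moreover have "\<bar>sin s * (Ci_prim s (2 + \<delta>) - Ci_prim s (2 - \<delta>)) / 2\<bar> \<le> \<delta>"
  proof -
    have "\<bar>Ci_prim s (2 + \<delta>) - Ci_prim s (2 - \<delta>)\<bar> \<le> (2 + \<delta> - (2 - \<delta>)) / (2 - \<delta>)"
      by (rule Ci_prim_diff_le) (use \<delta> in auto)
    also have "\<dots> \<le> 2 * \<delta>" using \<delta> by (simp add: field_simps)
    finally have "\<bar>Ci_prim s (2 + \<delta>) - Ci_prim s (2 - \<delta>)\<bar> \<le> 2 * \<delta>" .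
    moreover have "\<bar>sin s\<bar> * \<bar>Ci_prim s (2 + \<delta>) - Ci_prim s (2 - \<delta>)\<bar> \<le> 1 * \<bar>Ci_prim s (2 + \<delta>) - Ci_prim s (2 - \<delta>)\<bar>"
      by (intro mult_right_mono) auto
    ultimately show ?thesis by (simp add: abs_mult)
  qed
  ultimately show ?thesis by simp
qed

lemma LBINT_pv_integrand:
  assumes s: "s > 0" and \<delta>: "0 < \<delta>" "\<delta> < 1"
  shows "set_integrable lborel ({0..1-\<delta>} \<union> {1+\<delta>..}) (\<lambda>u. sin (u * s) / (u * (u\<^sup>2 - 1)))"
    and "(LBINT u:{0..1-\<delta>} \<union> {1+\<delta>..}. sin (u * s) / (u * (u\<^sup>2 - 1))) =
       pv_prim s (1 - \<delta>) - pv_prim s (1 + \<delta>) + pi / 2 * (cos s - 1)"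
proof -
  let ?T = "{0..1-\<delta>} \<union> {1+\<delta>..}" and ?m = "\<lambda>u. sin (u * s) / (u * (u\<^sup>2 - 1))"
  have 1: "set_integrable lborel ?T (\<lambda>u. sin (u * s) / (u\<^sup>2 - 1))"
    using set_integrable_sin_kernel[of 1 \<delta> s] \<delta>
    by (simp, elim set_integrable_subset) auto
  have 2: "set_integrable lborel ?T (\<lambda>u. sin (u * s) / (u * (u + 1)))"
    by (rule set_integrable_subset[OF rat_Si_integrable(1)]) (use s \<delta> in auto)
  \<comment> \<open>Integrability is inherited from two known integrands through
    \<open>1 / (u * (u^2 - 1)) = 1 / (u^2 - 1) - 1 / (u * (u + 1))\<close>.\<close>
  have "set_integrable lborel ?T (\<lambda>u. sin (u * s) / (u\<^sup>2 - 1) - sin (u * s) / (u * (u + 1)))"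
    by (rule set_integral_diff(1)[OF 1 2])
  also have "?this \<longleftrightarrow> set_integrable lborel ?T ?m"
  proof (rule set_integrable_cong[OF refl])
    fix u assume u: "u \<in> ?T"
    show "sin (u * s) / (u\<^sup>2 - 1) - sin (u * s) / (u * (u + 1)) = ?m u"
    proof (cases "u = 0")
      case False
      have "u\<^sup>2 - 1 = (u - 1) * (u + 1)" by (simp add: algebra_simps power2_eq_square)
      moreover have "u - 1 \<noteq> 0" "u + 1 \<noteq> 0" using u \<delta> by auto
      ultimately show ?thesis using False by (simp add: divide_simps) (simp add: algebra_simps)
    qed simp
  qed simp
  finally show int: "set_integrable lborel ?T ?m" .
  have i1: "set_integrable lborel {0..1-\<delta>} ?m" and i2: "set_integrable lborel {1+\<delta>..} ?m"
    by (rule set_integrable_subset[OF int]; auto)+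
  have I1: "(LBINT u:{0..1-\<delta>}. ?m u) = pv_prim s (1 - \<delta>)"
    using has_integral_pv_prim[OF s, of 0 "1 - \<delta>"] \<delta> i1 s
    by (simp add: set_borel_integral_eq_integral integral_unique)
  have "((\<lambda>A. LBINT u:{1+\<delta>..A}. ?m u) \<longlongrightarrow> (LBINT u:{1+\<delta>..}. ?m u)) at_top"
    by (rule tendsto_set_lebesgue_integral_at_top[OF _ i2]) auto
  moreover have "((\<lambda>A. LBINT u:{1+\<delta>..A}. ?m u) \<longlongrightarrow> pi / 2 * (cos s - 1) - pv_prim s (1 + \<delta>)) at_top"
  proof (rule tendsto_cong[THEN iffD1, OF _ tendsto_diff[OF tendsto_pv_prim_at_top[OF s] tendsto_const]])
    show "\<forall>\<^sub>F A in at_top. pv_prim s A - pv_prim s (1 + \<delta>) = (LBINT u:{1+\<delta>..A}. ?m u)"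
      using eventually_ge_at_top[of "1 + \<delta>"]
    proof eventually_elim
      case (elim A)
      have "set_integrable lborel {1+\<delta>..A} ?m" by (rule set_integrable_subset[OF i2]) auto
      then show ?case using has_integral_pv_prim[OF s, of "1 + \<delta>" A] elim \<delta>
        by (simp add: set_borel_integral_eq_integral integral_unique)
    qed
  qed
  ultimately have I2: "(LBINT u:{1+\<delta>..}. ?m u) = pi / 2 * (cos s - 1) - pv_prim s (1 + \<delta>)"
    using tendsto_unique trivial_limit_at_top_linorder by blast
  show "(LBINT u:?T. ?m u) = pv_prim s (1 - \<delta>) - pv_prim s (1 + \<delta>) + pi / 2 * (cos s - 1)"
    using \<delta> by (subst set_integral_Un[OF _ i1 i2]) (auto simp: I1 I2)
qed

text \<open>The truncated principal value integral at \<open>x = 1\<close>, without the factor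
  \<open>2 / pi\<close>; other \<open>x\<close> are reduced to it by scaling.\<close>

definition pv_kernel :: "real \<Rightarrow> real \<Rightarrow> real" where
  "pv_kernel \<delta> s = (LBINT u:{u. 0 < u \<and> \<delta> < \<bar>u - 1\<bar>}. sin (u * s) / (u\<^sup>2 - 1))"

text \<open>\<open>rat_Si\<close> carries no truncation; the last term corrects this on the excluded
  window.\<close>

lemma pv_kernel_eq:
  assumes s: "s > 0" and \<delta>: "0 < \<delta>" "\<delta> < 1"
  shows "pv_kernel \<delta> s = rat_Si s + pi / 2 * (cos s - 1) + (pv_prim s (1 - \<delta>) - pv_prim s (1 + \<delta>))
      - (LBINT u:{1-\<delta><..<1+\<delta>}. sin (u * s) / (u * (u + 1)))"
proof -
  let ?T = "{0..1-\<delta>} \<union> {1+\<delta>..}"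
  let ?k = "\<lambda>u. sin (u * s) / (u\<^sup>2 - 1)" and ?m = "\<lambda>u. sin (u * s) / (u * (u\<^sup>2 - 1))"
    and ?j = "\<lambda>u. sin (u * s) / (u * (u + 1))"
  have "pv_kernel \<delta> s = (LBINT u:?T. ?k u)"
    unfolding pv_kernel_def set_lebesgue_integral_def
  proof (rule integral_cong_AE)
    show "AE u in lborel. indicator {u. 0 < u \<and> \<delta> < \<bar>u - 1\<bar>} u *\<^sub>R ?k u = indicator ?T u *\<^sub>R ?k u"
      using AE_lborel_singleton[of 0] AE_lborel_singleton[of "1 - \<delta>"] AE_lborel_singleton[of "1 + \<delta>"]
      by eventually_elim (use \<delta> in \<open>auto split: split_indicator\<close>)
  qed measurable
  also have "\<dots> = (LBINT u:?T. ?j u + ?m u)"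
  proof (rule set_lebesgue_integral_cong)
    show "\<forall>u. u \<in> ?T \<longrightarrow> ?k u = ?j u + ?m u"
    proof (intro allI impI)
      fix u assume u: "u \<in> ?T"
      show "?k u = ?j u + ?m u"
      proof (cases "u = 0")
        case False
        have "u\<^sup>2 - 1 = (u - 1) * (u + 1)" by (simp add: algebra_simps power2_eq_square)
        moreover have "u - 1 \<noteq> 0" "u + 1 \<noteq> 0" using u \<delta> by auto
        ultimately show ?thesis using False by (simp add: divide_simps) (simp add: algebra_simps)
      qed simp
    qed
  qed simp
  also have "\<dots> = (LBINT u:?T. ?j u) + (LBINT u:?T. ?m u)"
    by (rule set_integral_add(2)[OF set_integrable_subset[OF rat_Si_integrable(1)] LBINT_pv_integrand(1)[OF s \<delta>]])
       (use s \<delta> in auto)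
  also have "(LBINT u:?T. ?j u) = rat_Si s - (LBINT u:{1-\<delta><..<1+\<delta>}. ?j u)"
  proof -
    have "rat_Si s = (LBINT u:?T \<union> {1-\<delta><..<1+\<delta>}. ?j u)"
      unfolding rat_Si_def by (rule arg_cong[of _ _ "\<lambda>S. set_lebesgue_integral lborel S ?j"]) (use \<delta> in auto)
    also have "\<dots> = (LBINT u:?T. ?j u) + (LBINT u:{1-\<delta><..<1+\<delta>}. ?j u)"
      by (rule set_integral_Un) (use s \<delta> in \<open>auto intro!: set_integrable_subset[OF rat_Si_integrable(1)]\<close>)
    finally show ?thesis by simp
  qed
  finally show ?thesis using LBINT_pv_integrand(2)[OF s \<delta>] by simp
qed

lemma abs_rat_Si_middle_le:
  fixes s \<delta> :: real
  assumes s: "s > 0" and \<delta>: "0 < \<delta>" "\<delta> \<le> 1 / 2"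
  shows "\<bar>LBINT u:{1-\<delta><..<1+\<delta>}. sin (u * s) / (u * (u + 1))\<bar> \<le> 4 * \<delta>"
proof -
  have "norm (LBINT u:{1-\<delta><..<1+\<delta>}. sin (u * s) / (u * (u + 1))) \<le> (LBINT u:{1-\<delta><..<1+\<delta>}. 2)"
  proof (rule norm_set_integral_le)
    show "set_integrable lborel {1-\<delta><..<1+\<delta>} (\<lambda>u. sin (u * s) / (u * (u + 1)))"
      by (rule set_integrable_subset[OF rat_Si_integrable(1)[of s]]) (use s \<delta> in auto)
    show "set_integrable lborel {1-\<delta><..<1+\<delta>} (\<lambda>u. 2 :: real)"
      using \<delta> by (simp add: set_integrable_def integrable_indicator_iff)
    fix u assume "u \<in> {1-\<delta><..<1+\<delta>}"
    then have u: "u \<ge> 1 / 2" using \<delta> by auto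
    \<comment> \<open>This bounds the integrand by 2; the window has length
      \<open>2 * \<delta>\<close>, whence \<open>4 * \<delta>\<close>.\<close>
    have "1 / 2 * 1 \<le> u * (u + 1)" using u by (intro mult_mono) auto
    moreover have "\<bar>sin (u * s)\<bar> \<le> 1" by simp
    ultimately have "\<bar>sin (u * s)\<bar> \<le> 2 * (u * (u + 1))" by linarith
    then show "norm (sin (u * s) / (u * (u + 1))) \<le> 2" using u by (simp add: abs_mult divide_simps)
  qed
  also have "(LBINT u:{1-\<delta><..<1+\<delta>}. 2) = 4 * \<delta>"
    using \<delta> by (simp add: set_lebesgue_integral_def)
  finally show ?thesis by simp
qed

text \<open>The bound has to be uniform in \<open>s\<close> as well as in \<open>\<delta>\<close>,
  because it is to dominate \<open>pv_kernel (\<delta> / x) (x * t)\<close> for all positive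
  \<open>t\<close> when the limit is taken under the integral.\<close>

lemma bounded_pv_kernel:
  obtains B where "\<And>s \<delta>. \<lbrakk>s > 0; 0 < \<delta>; \<delta> \<le> 1 / 2\<rbrakk> \<Longrightarrow> \<bar>pv_kernel \<delta> s\<bar> \<le> B"
proof -
  obtain B1 where B1: "\<And>T. \<bar>Si T\<bar> \<le> B1" using bounded_Si by blast
  obtain B2 where B2: "\<And>s. s > 0 \<Longrightarrow> \<bar>rat_Si s\<bar> \<le> B2" using bounded_rat_Si by blast
  show thesis
  proof (rule that)
    fix s \<delta> :: real assume *: "s > 0" "0 < \<delta>" "\<delta> \<le> 1 / 2"
    define c where "c = cos s * (Si ((2 - \<delta>) * s) - Si ((2 + \<delta>) * s) - 2 * Si (\<delta> * s)) / 2"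
    have "\<bar>cos s\<bar> * \<bar>Si ((2 - \<delta>) * s) - Si ((2 + \<delta>) * s) - 2 * Si (\<delta> * s)\<bar> \<le> 1 * (4 * B1)"
    proof (rule mult_mono)
      show "\<bar>Si ((2 - \<delta>) * s) - Si ((2 + \<delta>) * s) - 2 * Si (\<delta> * s)\<bar> \<le> 4 * B1"
        using B1[of "(2 - \<delta>) * s"] B1[of "(2 + \<delta>) * s"] B1[of "\<delta> * s"] by linarith
    qed auto
    then have c: "\<bar>c\<bar> \<le> 2 * B1" by (simp add: c_def abs_mult)
    have jump: "\<bar>pv_prim s (1 - \<delta>) - pv_prim s (1 + \<delta>)\<bar> \<le> 4 * B1 + 1"
      using pv_prim_jump[of s \<delta>, folded c_def] * c B1[of "(1 + \<delta>) * s"] B1[of "(1 - \<delta>) * s"] by linarith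
    have "\<bar>pi / 2 * (cos s - 1)\<bar> = pi / 2 * \<bar>cos s - 1\<bar>" by (simp add: abs_mult)
    also have "\<dots> \<le> pi / 2 * 2" using abs_cos_le_one[of s] by (intro mult_left_mono) (linarith, simp)
    finally have "\<bar>pi / 2 * (cos s - 1)\<bar> \<le> pi" by simp
    then show "\<bar>pv_kernel \<delta> s\<bar> \<le> B2 + pi + (4 * B1 + 1) + 2"
      using pv_kernel_eq[of s \<delta>] jump B2[of s] abs_rat_Si_middle_le[of s \<delta>] * by linarith
  qed
qed

lemma tendsto_pv_kernel:
  assumes s: "s > 0"
  shows "((\<lambda>\<delta>. pv_kernel \<delta> s) \<longlongrightarrow> rat_Si s + pi / 2 * (cos s - 1)) (at_right 0)"
proof -
  define c where "c \<delta> = (Si ((1 + \<delta>) * s) - Si ((1 - \<delta>) * s)) +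
     cos s * (Si ((2 - \<delta>) * s) - Si ((2 + \<delta>) * s) - 2 * Si (\<delta> * s)) / 2" for \<delta>
  have Si0: "Si 0 = 0" using Si_neg[of 0] by simp
  have Si: "((\<lambda>\<delta>. Si ((a + b * \<delta>) * s)) \<longlongrightarrow> Si ((a + b * 0) * s)) (at_right 0)" for a b
    by (rule isCont_tendsto_compose[OF isCont_Si]) (intro tendsto_intros)
  have "(c \<longlongrightarrow> (Si (1 * s) - Si (1 * s)) + cos s * (Si (2 * s) - Si (2 * s) - 2 * Si (0 * s)) / 2) (at_right 0)"
    unfolding c_def[abs_def]
    using Si[of 1 1] Si[of 1 "- 1"] Si[of 2 "- 1"] Si[of 2 1] Si[of 0 1]
    by (intro tendsto_intros) simp_all
  then have c: "(c \<longlongrightarrow> 0) (at_right 0)" using Si0 by simp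
  have ev: "\<forall>\<^sub>F \<delta> in at_right 0. 0 < \<delta> \<and> \<delta> \<le> (1/2::real)"
    unfolding eventually_at_right_field by (intro exI[of _ "1/2"]) auto
  \<comment> \<open>The error consists of \<open>c \<delta>\<close>, at most \<open>\<delta>\<close>
    from the jump, and at most \<open>4 * \<delta>\<close> from the window; hence the
    \<open>5 * \<delta>\<close> below.\<close>
  have "((\<lambda>\<delta>. pv_kernel \<delta> s - (rat_Si s + pi / 2 * (cos s - 1))) \<longlongrightarrow> 0) (at_right 0)"
  proof (rule Lim_null_comparison)
    show "\<forall>\<^sub>F \<delta> in at_right 0. norm (pv_kernel \<delta> s - (rat_Si s + pi / 2 * (cos s - 1))) \<le> \<bar>c \<delta>\<bar> + 5 * \<delta>"
      using ev
    proof eventually_elim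
      case (elim \<delta>)
      then show ?case
        using pv_kernel_eq[of s \<delta>] pv_prim_jump[of s \<delta>, folded c_def] abs_rat_Si_middle_le[of s \<delta>] s
        unfolding real_norm_def by linarith
    qed
    have "((\<lambda>\<delta>. \<bar>c \<delta>\<bar> + 5 * \<delta>) \<longlongrightarrow> \<bar>0\<bar> + 5 * 0) (at_right 0)"
      by (intro tendsto_intros c)
    then show "((\<lambda>\<delta>. \<bar>c \<delta>\<bar> + 5 * \<delta>) \<longlongrightarrow> 0) (at_right 0)" by simp
  qed
  then show ?thesis by (simp add: LIM_zero_iff)
qed

subsection \<open>Sine transforms of primitives\<close>

text \<open>The theorem speaks of Lebesgue measure and of \<open>ae_deriv f\<close>, whereas
  Radon-Nikodym and Fubini are applied on \<open>lborel\<close> to a Borel density. This is the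
  bridge between the two.\<close>

lemma set_integral_lebesgue_eq_lborel:
  fixes \<phi> \<psi> :: "real \<Rightarrow> 'a::euclidean_space"
  assumes \<psi>: "set_integrable lborel S \<psi>" and N: "negligible N" and eq: "\<And>t. t \<in> S - N \<Longrightarrow> \<phi> t = \<psi> t"
  shows "\<phi> absolutely_integrable_on S" and "(LINT t:S|lebesgue. \<phi> t) = (LINT t:S|lborel. \<psi> t)"
proof -
  have "integrable lebesgue (\<lambda>t. indicator S t *\<^sub>R \<psi> t)"
    using \<psi> unfolding set_integrable_def by (subst integrable_completion) auto
  then have "\<psi> absolutely_integrable_on S" by (simp add: set_integrable_def)
  then show \<phi>: "\<phi> absolutely_integrable_on S"
    using N eq by (rule absolutely_integrable_spike)
  have "integral S \<psi> = integral S \<phi>" by (rule integral_spike[OF N eq])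
  then show "(LINT t:S|lebesgue. \<phi> t) = (LINT t:S|lborel. \<psi> t)"
    using set_lebesgue_integral_eq_integral(2)[OF \<phi>] set_borel_integral_eq_integral(2)[OF \<psi>] by simp
qed

lemma integrable_mult_bounded_kernel:
  fixes p :: "real \<Rightarrow> real" and q :: "real \<Rightarrow> complex" and K :: "real \<Rightarrow> real \<Rightarrow> real"
  assumes p: "integrable lborel p" and q: "integrable lborel q"
    and K: "(\<lambda>(u, t). K u t) \<in> borel_measurable (lborel \<Otimes>\<^sub>M lborel)" "\<And>u t. \<bar>K u t\<bar> \<le> 1"
  shows "integrable (lborel \<Otimes>\<^sub>M lborel) (\<lambda>(u, t). (p u * K u t) *\<^sub>R q t)"
proof (rule Bochner_Integration.integrable_bound)
  have [measurable]: "p \<in> borel_measurable borel" "q \<in> borel_measurable borel" using p q by auto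
  show "integrable (lborel \<Otimes>\<^sub>M lborel) (\<lambda>(u, t). p u *\<^sub>R q t)"
  proof (rule lborel_pair.Fubini_integrable)
    show "integrable lborel (\<lambda>u. LINT t|lborel. norm (case (u, t) of (u, t) \<Rightarrow> p u *\<^sub>R q t))"
      using p by simp
    show "AE u in lborel. integrable lborel (\<lambda>t. case (u, t) of (u, t) \<Rightarrow> p u *\<^sub>R q t)"
      using q by simp
  qed measurable
  note K(1)[measurable]
  show "(\<lambda>(u, t). (p u * K u t) *\<^sub>R q t) \<in> borel_measurable (lborel \<Otimes>\<^sub>M lborel)"
    unfolding split_beta' by (intro borel_measurable_scaleR borel_measurable_times) (use K(1) in \<open>auto simp: split_beta'\<close>)
  show "AE z in lborel \<Otimes>\<^sub>M lborel. norm (case z of (u, t) \<Rightarrow> (p u * K u t) *\<^sub>R q t) \<le> norm (case z of (u, t) \<Rightarrow> p u *\<^sub>R q t)"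
  proof (rule AE_I2)
    fix z :: "real \<times> real"
    obtain u t where z: "z = (u, t)" by (cases z)
    have "\<bar>p u\<bar> * (\<bar>K u t\<bar> * norm (q t)) \<le> \<bar>p u\<bar> * (1 * norm (q t))"
      by (intro mult_left_mono mult_right_mono K(2)) auto
    then show "norm (case z of (u, t) \<Rightarrow> (p u * K u t) *\<^sub>R q t) \<le> norm (case z of (u, t) \<Rightarrow> p u *\<^sub>R q t)"
      by (simp add: z abs_mult mult.assoc)
  qed
qed

text \<open>Serves two purposes: with a sine as \<open>K\<close> it exchanges the integrals in the
  truncated Hilbert transform; with the indicator of an ordering as \<open>K\<close> it takes the
  place of integration by parts.\<close>

lemma Fubini_bounded_kernel:
  fixes p :: "real \<Rightarrow> real" and q :: "real \<Rightarrow> complex" and K :: "real \<Rightarrow> real \<Rightarrow> real"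
  assumes "integrable lborel p" "integrable lborel q"
    "(\<lambda>(u, t). K u t) \<in> borel_measurable (lborel \<Otimes>\<^sub>M lborel)" "\<And>u t. \<bar>K u t\<bar> \<le> 1"
  shows "(LBINT u. p u *\<^sub>R (LBINT t. K u t *\<^sub>R q t)) = (LBINT t. (LBINT u. p u * K u t) *\<^sub>R q t)"
    and "integrable lborel (\<lambda>u. p u *\<^sub>R (LBINT t. K u t *\<^sub>R q t))"
proof -
  note int = integrable_mult_bounded_kernel[OF assms]
  have inner: "(LBINT t. (p u * K u t) *\<^sub>R q t) = p u *\<^sub>R (LBINT t. K u t *\<^sub>R q t)" for u
    by (simp flip: scaleR_scaleR)
  show "integrable lborel (\<lambda>u. p u *\<^sub>R (LBINT t. K u t *\<^sub>R q t))"
    using lborel_pair.integrable_fst[OF int] unfolding inner .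
  have "(LBINT t. LBINT u. (p u * K u t) *\<^sub>R q t) = (LBINT u. LBINT t. (p u * K u t) *\<^sub>R q t)"
    by (rule lborel_pair.Fubini_integral[OF int])
  moreover have "(LBINT u. (p u * K u t) *\<^sub>R q t) = (LBINT u. p u * K u t) *\<^sub>R q t" for t
  proof (rule integral_scaleR_left)
    have "(\<lambda>u. K u t) \<in> borel_measurable lborel" using measurable_Pair1[OF assms(3), of t] by simp
    then have "(\<lambda>u. p u * K u t) \<in> borel_measurable lborel" using assms(1) by simp
    then show "integrable lborel (\<lambda>u. p u * K u t)"
      using assms(4) by (intro Bochner_Integration.integrable_bound[OF assms(1)]) (auto simp: abs_mult mult_left_le)
  qed
  ultimately show "(LBINT u. p u *\<^sub>R (LBINT t. K u t *\<^sub>R q t)) = (LBINT t. (LBINT u. p u * K u t) *\<^sub>R q t)"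
    unfolding inner by simp
qed

text \<open>From here on \<open>f\<close> enters only through its increments and its limit. Since
  \<open>g\<close> vanishes for nonpositive arguments, kernels have to be controlled for positive
  \<open>t\<close> only.\<close>

locale half_line_primitive =
  fixes f g :: "real \<Rightarrow> complex"
  assumes g_integrable: "integrable lborel g"
    and g_zero: "\<And>t. t \<le> 0 \<Longrightarrow> g t = 0"
    and f_diff: "\<And>a b. \<lbrakk>0 \<le> a; a \<le> b\<rbrakk> \<Longrightarrow> f b - f a = (LBINT t:{a..b}. g t)"
    and f_lim: "(f \<longlongrightarrow> 0) at_top"
begin

lemma g_measurable [measurable]: "g \<in> borel_measurable borel"
  using g_integrable by auto

lemma g_set_integrable: "S \<in> sets borel \<Longrightarrow> set_integrable lborel S g"
  unfolding set_integrable_def using g_integrable by (intro integrable_mult_indicator) auto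

lemma f_eq_integral: "0 \<le> t \<Longrightarrow> f t = f 0 + integral {0..t} g"
  using f_diff[of 0 t] set_borel_integral_eq_integral(2)[OF g_set_integrable, of "{0..t}"]
  by (simp add: algebra_simps)

lemma continuous_on_f: "continuous_on {0..} f"
proof -
  have "continuous (at t within {0..}) f" if t: "0 \<le> t" for t
  proof -
    have "g integrable_on {0..t + 1}"
      by (rule set_borel_integral_eq_integral(1)[OF g_set_integrable]) auto
    then have "continuous_on {0..t + 1} (\<lambda>u. f 0 + integral {0..u} g)"
      by (intro continuous_intros indefinite_integral_continuous_1)
    then have "continuous_on {0..t + 1} f"
      by (rule continuous_on_eq) (simp flip: f_eq_integral)
    then have "continuous (at t within {0..t + 1}) f"
      using t by (simp add: continuous_on_eq_continuous_within)
    moreover have "at t within {0..t + 1} = at t within {0..}"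
      by (rule at_within_nhd[of _ "{t - 1<..<t + 1}"]) auto
    ultimately show ?thesis by simp
  qed
  then show ?thesis by (simp add: continuous_on_eq_continuous_within)
qed

lemma f_eq_tail:
  assumes "0 \<le> a"
  shows "f a = - (LBINT t:{a..}. g t)"
proof -
  have "((\<lambda>b. LBINT t:{a..b}. g t) \<longlongrightarrow> (LBINT t:{a..}. g t)) at_top"
    by (rule tendsto_set_lebesgue_integral_at_top) (auto intro: g_set_integrable)
  moreover have "((\<lambda>b. LBINT t:{a..b}. g t) \<longlongrightarrow> 0 - f a) at_top"
  proof (rule tendsto_cong[THEN iffD1, OF _ tendsto_diff[OF f_lim tendsto_const]])
    show "\<forall>\<^sub>F b in at_top. f b - f a = (LBINT t:{a..b}. g t)"
      using eventually_ge_at_top[of a] by eventually_elim (use f_diff assms in auto)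
  qed
  ultimately have "0 - f a = (LBINT t:{a..}. g t)"
    using tendsto_unique trivial_limit_at_top_linorder by blast
  then show ?thesis by (metis diff_0 minus_minus)
qed

lemma ae_deriv_eq:
  obtains N where "negligible N" "\<And>t. t \<in> {0..} - N \<Longrightarrow> ae_deriv f t = g t"
proof -
  define B where "B n = {x\<in>{0..real n}. \<not> ((\<lambda>u. integral {0..u} g) has_vector_derivative g x) (at x within {0..real n})}" for n
  have "negligible (B n)" for n
    unfolding B_def
    by (intro negligible_not_has_vector_derivative_integral set_borel_integral_eq_integral(1)[OF g_set_integrable]) auto
  \<comment> \<open>At 0 the two-sided derivative depends on the arbitrary values of
    \<open>f\<close> at negative arguments, so this point joins the exceptional set.\<close>
  then have "negligible (insert 0 (\<Union>n. B n))"
    unfolding negligible_insert by (intro negligible_countable_Union) auto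
  moreover have "ae_deriv f t = g t" if t: "t \<in> {0..} - insert 0 (\<Union>n. B n)" for t
  proof -
    have "t > 0" using t by auto
    obtain n where n: "t < real n" using reals_Archimedean2 by blast
    have "((\<lambda>u. integral {0..u} g) has_vector_derivative g t) (at t within {0..real n})"
      using t n by (auto simp: B_def)
    moreover have "at t within {0..real n} = at t"
      by (rule at_within_interior) (use \<open>t > 0\<close> n in auto)
    ultimately have "((\<lambda>u. integral {0..u} g) has_vector_derivative g t) (at t)" by simp
    then have "((\<lambda>u. f 0 + integral {0..u} g) has_vector_derivative 0 + g t) (at t)"
      by (intro has_vector_derivative_add has_vector_derivative_const)
    then have "(f has_vector_derivative 0 + g t) (at t)"
      by (rule has_vector_derivative_transform_within_open[of _ _ _ "{0<..}"])
         (use \<open>t > 0\<close> in \<open>auto simp flip: f_eq_integral\<close>)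
    then show ?thesis by (simp add: vector_derivative_at)
  qed
  ultimately show thesis using that by blast
qed

lemma ae_deriv_absolutely_integrable: "ae_deriv f absolutely_integrable_on {0..}"
proof -
  obtain N where N: "negligible N" "\<And>t. t \<in> {0..} - N \<Longrightarrow> ae_deriv f t = g t"
    by (rule ae_deriv_eq) (rule that)
  show ?thesis
    by (rule set_integral_lebesgue_eq_lborel(1)[OF g_set_integrable N]) auto
qed

lemma L1_norm_ae_deriv: "L1_norm (ae_deriv f) = (LBINT t. norm (g t))"
proof -
  obtain N where N: "negligible N" "\<And>t. t \<in> {0..} - N \<Longrightarrow> ae_deriv f t = g t"
    by (rule ae_deriv_eq) (rule that)
  have "L1_norm (ae_deriv f) = (LBINT t:{0..}. norm (g t))"
    unfolding L1_norm_def
    by (rule set_integral_lebesgue_eq_lborel(2)[OF set_integrable_norm[OF g_set_integrable] N(1)])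
       (use N in auto)
  also have "\<dots> = (LBINT t. norm (g t))"
    unfolding set_lebesgue_integral_def
    by (rule Bochner_Integration.integral_cong) (auto simp: g_zero split: split_indicator)
  finally show ?thesis .
qed

lemma g_mult_integrable:
  assumes "h \<in> borel_measurable borel" "\<And>t. t > 0 \<Longrightarrow> \<bar>h t\<bar> \<le> B"
  shows "integrable lborel (\<lambda>t. h t *\<^sub>R g t)"
proof (rule Bochner_Integration.integrable_bound)
  show "integrable lborel (\<lambda>t. B *\<^sub>R g t)" using g_integrable by simp
  show "(\<lambda>t. h t *\<^sub>R g t) \<in> borel_measurable lborel" using assms(1) by simp
  show "AE t in lborel. norm (h t *\<^sub>R g t) \<le> norm (B *\<^sub>R g t)"
  proof (rule AE_I2)
    fix t
    show "norm (h t *\<^sub>R g t) \<le> norm (B *\<^sub>R g t)"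
    proof (cases "t > 0")
      case True
      then have "\<bar>h t\<bar> \<le> \<bar>B\<bar>" using assms(2)[of t] by linarith
      then show ?thesis by (simp add: mult_right_mono)
    qed (simp add: g_zero)
  qed
qed

lemma sine_transform_ae_deriv:
  "sine_transform (ae_deriv f) u = (LBINT t. sin (u * t) *\<^sub>R g t)"
proof -
  obtain N where N: "negligible N" "\<And>t. t \<in> {0..} - N \<Longrightarrow> ae_deriv f t = g t"
    by (rule ae_deriv_eq) (rule that)
  have int: "integrable lborel (\<lambda>t. sin (u * t) *\<^sub>R g t)"
    by (rule g_mult_integrable[of _ 1]) auto
  then have sint: "set_integrable lborel S (\<lambda>t. sin (u * t) *\<^sub>R g t)" if "S \<in> sets borel" for S
    unfolding set_integrable_def using that by (intro integrable_mult_indicator) auto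
  have "sine_integral_upto (ae_deriv f) u = (\<lambda>A. LBINT t:{0..A}. sin (u * t) *\<^sub>R g t)"
    unfolding sine_integral_upto_def
    by (intro ext set_integral_lebesgue_eq_lborel(2)[OF sint N(1)]) (use N(2) in \<open>auto simp: scaleR_conv_of_real\<close>)
  then have "(sine_integral_upto (ae_deriv f) u \<longlongrightarrow> (LBINT t:{0..}. sin (u * t) *\<^sub>R g t)) at_top"
    using tendsto_set_lebesgue_integral_at_top[OF _ sint[of "{0..}"]] by simp
  also have "(LBINT t:{0..}. sin (u * t) *\<^sub>R g t) = (LBINT t. sin (u * t) *\<^sub>R g t)"
    unfolding set_lebesgue_integral_def
    by (rule Bochner_Integration.integral_cong) (auto simp: g_zero split: split_indicator)
  finally show ?thesis unfolding sine_transform_def by (intro tendsto_Lim) auto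
qed

text \<open>Integration by parts, done as Fubini over the triangle
  \<open>0 \<le> t \<le> r \<le> A\<close> with \<open>f A - f t\<close> written as an integral of
  \<open>g\<close>; this avoids a product rule for a function differentiable only almost everywhere.
  The primitive \<open>(1 - cos (x * t)) / x\<close> vanishes at 0, so no boundary term arises
  there.\<close>

lemma sine_integral_upto_f:
  assumes x: "x > 0" and A: "A \<ge> 0"
  shows "sine_integral_upto f x A = ((1 - cos (x * A)) / x) *\<^sub>R f A - (LBINT t:{0..A}. ((1 - cos (x * t)) / x) *\<^sub>R g t)"
proof -
  have sin_int: "(LBINT t:{0..r}. sin (x * t)) = (1 - cos (x * r)) / x" if "r \<ge> 0" for r
  proof -
    have "((\<lambda>t. sin (x * t)) has_integral (- cos (x * r) / x - (- cos (x * 0) / x))) {0..r}"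
    proof (rule fundamental_theorem_of_calculus[OF that])
      fix t :: real
      show "((\<lambda>t. - cos (x * t) / x) has_vector_derivative sin (x * t)) (at t within {0..r})"
        unfolding has_real_derivative_iff_has_vector_derivative[symmetric]
        using x by (auto intro!: derivative_eq_intros)
    qed
    moreover have "set_integrable lborel {0..r} (\<lambda>t. sin (x * t))"
      by (rule borel_integrable_atLeastAtMost') (intro continuous_intros)
    ultimately show ?thesis
      by (simp add: set_borel_integral_eq_integral integral_unique diff_divide_distrib)
  qed
  define p where "p t = indicator {0..A} t * sin (x * t)" for t
  define K where "K t r = (if t \<le> r \<and> r \<le> A then 1 else 0 :: real)" for t r
  have p: "integrable lborel p"
    using borel_integrable_atLeastAtMost'[of 0 A "\<lambda>t. sin (x * t)"]
    by (simp add: p_def[abs_def] set_integrable_def continuous_intros)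
  have K: "(\<lambda>(t, r). K t r) \<in> borel_measurable (lborel \<Otimes>\<^sub>M lborel)" "\<bar>K t r\<bar> \<le> 1" for t r
    unfolding K_def by auto
  have inner1: "p t *\<^sub>R (LBINT r. K t r *\<^sub>R g r) = p t *\<^sub>R f A - indicator {0..A} t *\<^sub>R (f t * of_real (sin (x * t)))" for t
  proof (cases "t \<in> {0..A}")
    case True
    have "(LBINT r. K t r *\<^sub>R g r) = (LBINT r:{t..A}. g r)"
      unfolding set_lebesgue_integral_def K_def
      by (rule Bochner_Integration.integral_cong) (auto split: split_indicator)
    also have "\<dots> = f A - f t" using f_diff[of t A] True by simp
    finally show ?thesis using True by (simp add: p_def scaleR_diff_right) (simp add: scaleR_conv_of_real)
  qed (simp add: p_def)
  have inner2: "(LBINT t. p t * K t r) *\<^sub>R g r = indicator {0..A} r *\<^sub>R (((1 - cos (x * r)) / x) *\<^sub>R g r)" for r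
  proof (cases "0 < r \<and> r \<le> A")
    case True
    have "(LBINT t. p t * K t r) = (LBINT t:{0..r}. sin (x * t))"
      unfolding set_lebesgue_integral_def K_def p_def
      by (rule Bochner_Integration.integral_cong) (use True in \<open>auto split: split_indicator\<close>)
    then show ?thesis using True sin_int[of r] by simp
  next
    case False
    \<comment> \<open>Arguments \<open>r \<le> 0\<close> drop out through \<open>g\<close>,
      arguments \<open>r > A\<close> through \<open>K\<close>.\<close>
    then have "g r = 0 \<or> (\<forall>t. K t r = 0)" by (auto simp: K_def g_zero)
    then show ?thesis using False by (auto simp: K_def g_zero split: split_indicator)
  qed
  have rearrange: "b = a - c" if "a - b = c" for a b c :: complex using that by auto
  have fsin: "continuous_on {0..A} (\<lambda>t. f t * of_real (sin (x * t)))"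
    by (intro continuous_intros continuous_on_subset[OF continuous_on_f]) auto
  then have fint: "set_integrable lborel {0..A} (\<lambda>t. f t * of_real (sin (x * t)))"
    by (rule borel_integrable_atLeastAtMost')
  have "(LBINT t. p t *\<^sub>R f A - indicator {0..A} t *\<^sub>R (f t * of_real (sin (x * t)))) =
      (LBINT r:{0..A}. ((1 - cos (x * r)) / x) *\<^sub>R g r)"
    using Fubini_bounded_kernel(1)[OF p g_integrable K] unfolding inner1 inner2 set_lebesgue_integral_def .
  also have "(LBINT t. p t *\<^sub>R f A - indicator {0..A} t *\<^sub>R (f t * of_real (sin (x * t)))) =
      (LBINT t. p t) *\<^sub>R f A - (LBINT t:{0..A}. f t * of_real (sin (x * t)))"
    using p fint unfolding set_lebesgue_integral_def set_integrable_def
    by (subst Bochner_Integration.integral_diff) auto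
  also have "(LBINT t. p t) = (1 - cos (x * A)) / x"
    using sin_int[OF A] by (simp add: p_def set_lebesgue_integral_def)
  finally have "(LBINT t:{0..A}. f t * of_real (sin (x * t))) =
      ((1 - cos (x * A)) / x) *\<^sub>R f A - (LBINT t:{0..A}. ((1 - cos (x * t)) / x) *\<^sub>R g t)"
    by (rule rearrange)
  moreover have "sine_integral_upto f x A = (LBINT t:{0..A}. f t * of_real (sin (x * t)))"
    unfolding sine_integral_upto_def
    by (rule set_integral_lebesgue_eq_lborel(2)[OF fint negligible_empty]) auto
  ultimately show ?thesis by simp
qed

text \<open>The boundary term at \<open>A\<close> is a bounded factor times \<open>f A\<close> and
  vanishes in the limit; the rest converges absolutely. Thus the improper integral exists although
  \<open>f\<close> itself may fail to be integrable.\<close>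

lemma sine_transform_f:
  assumes x: "x > 0"
  shows "sine_transform_exists f x"
    and "sine_transform f x = (LBINT t. ((cos (x * t) - 1) / x) *\<^sub>R g t)"
proof -
  have bound: "\<bar>(1 - cos (x * t)) / x\<bar> \<le> 2 / x" for t
  proof -
    have "\<bar>1 - cos (x * t)\<bar> \<le> 2" using abs_cos_le_one[of "x * t"] by linarith
    then show ?thesis using x by (simp add: divide_right_mono)
  qed
  have "((\<lambda>A. ((1 - cos (x * A)) / x) *\<^sub>R f A) \<longlongrightarrow> 0) at_top"
  proof (rule Lim_null_comparison)
    show "\<forall>\<^sub>F A in at_top. norm (((1 - cos (x * A)) / x) *\<^sub>R f A) \<le> 2 / x * norm (f A)"
      using mult_right_mono[OF bound] by (intro always_eventually) simp
    show "((\<lambda>A. 2 / x * norm (f A)) \<longlongrightarrow> 0) at_top"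
      using tendsto_mult[OF tendsto_const tendsto_norm[OF f_lim], of "2 / x"] by simp
  qed
  moreover have int: "integrable lborel (\<lambda>t. ((1 - cos (x * t)) / x) *\<^sub>R g t)"
    by (rule g_mult_integrable[of _ "2 / x"]) (use bound in auto)
  then have "set_integrable lborel {0..} (\<lambda>t. ((1 - cos (x * t)) / x) *\<^sub>R g t)"
    unfolding set_integrable_def by (intro integrable_mult_indicator) auto
  then have "((\<lambda>A. LBINT t:{0..A}. ((1 - cos (x * t)) / x) *\<^sub>R g t) \<longlongrightarrow>
      (LBINT t:{0..}. ((1 - cos (x * t)) / x) *\<^sub>R g t)) at_top"
    by (intro tendsto_set_lebesgue_integral_at_top) auto
  ultimately have "((\<lambda>A. ((1 - cos (x * A)) / x) *\<^sub>R f A - (LBINT t:{0..A}. ((1 - cos (x * t)) / x) *\<^sub>R g t)) \<longlongrightarrow>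
      0 - (LBINT t:{0..}. ((1 - cos (x * t)) / x) *\<^sub>R g t)) at_top"
    by (rule tendsto_diff)
  also have "0 - (LBINT t:{0..}. ((1 - cos (x * t)) / x) *\<^sub>R g t) = (LBINT t. ((cos (x * t) - 1) / x) *\<^sub>R g t)"
  proof -
    have "(LBINT t:{0..}. ((1 - cos (x * t)) / x) *\<^sub>R g t) = (LBINT t. - (((cos (x * t) - 1) / x) *\<^sub>R g t))"
      unfolding set_lebesgue_integral_def
      by (rule Bochner_Integration.integral_cong)
         (auto simp: g_zero diff_divide_distrib scaleR_diff_left split: split_indicator)
    then show ?thesis by simp
  qed
  finally have lim: "(sine_integral_upto f x \<longlongrightarrow> (LBINT t. ((cos (x * t) - 1) / x) *\<^sub>R g t)) at_top"
  proof (rule tendsto_cong[THEN iffD1, rotated])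
    show "\<forall>\<^sub>F A in at_top. ((1 - cos (x * A)) / x) *\<^sub>R f A - (LBINT t:{0..A}. ((1 - cos (x * t)) / x) *\<^sub>R g t) = sine_integral_upto f x A"
      using eventually_ge_at_top[of 0] by eventually_elim (use sine_integral_upto_f[OF x] in auto)
  qed
  have "(\<lambda>t. f t * of_real (sin (x * t))) absolutely_integrable_on {0..A}" for A
    by (rule absolutely_integrable_continuous_real)
       (intro continuous_intros continuous_on_subset[OF continuous_on_f], auto)
  with lim show "sine_transform_exists f x" unfolding sine_transform_exists_def by blast
  show "sine_transform f x = (LBINT t. ((cos (x * t) - 1) / x) *\<^sub>R g t)"
    unfolding sine_transform_def using lim by (intro tendsto_Lim) auto
qed

end

subsection \<open>The Hilbert transform and the remainder\<close>

lemma rat_Si_measurable [measurable]: "rat_Si \<in> borel_measurable borel"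
  unfolding rat_Si_def[abs_def] set_lebesgue_integral_def by measurable

lemma pv_kernel_measurable [measurable]: "pv_kernel \<delta> \<in> borel_measurable borel"
  unfolding pv_kernel_def[abs_def] set_lebesgue_integral_def by measurable

text \<open>Substitution \<open>u = x * w\<close>: the measure contributes \<open>x\<close>, the
  denominator \<open>1 / x^2\<close>, and the window around \<open>x\<close> becomes one of radius
  \<open>\<delta> / x\<close> around 1.\<close>

lemma LBINT_sin_kernel_scaled:
  assumes x: "x > 0"
  shows "(LBINT u:{u. 0 < u \<and> \<delta> < \<bar>u - x\<bar>}. sin (u * t) / (u\<^sup>2 - x\<^sup>2)) = (1 / x) * pv_kernel (\<delta> / x) (x * t)"
proof -
  let ?F = "\<lambda>u. indicator {u. 0 < u \<and> \<delta> < \<bar>u - x\<bar>} u *\<^sub>R (sin (u * t) / (u\<^sup>2 - x\<^sup>2))"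
  have "?F (0 + x * w) = (1 / x\<^sup>2) * (indicator {u. 0 < u \<and> \<delta> / x < \<bar>u - 1\<bar>} w *\<^sub>R (sin (w * (x * t)) / (w\<^sup>2 - 1)))" for w
  proof -
    have "x * w - x = x * (w - 1)" by (simp add: algebra_simps)
    then have "\<bar>x * w - x\<bar> = x * \<bar>w - 1\<bar>" using x by (simp only: abs_mult abs_of_pos)
    then have "\<delta> < \<bar>x * w - x\<bar> \<longleftrightarrow> \<delta> / x < \<bar>w - 1\<bar>" using x by (simp add: pos_divide_less_eq mult.commute)
    moreover have "(x * w)\<^sup>2 - x\<^sup>2 = x\<^sup>2 * (w\<^sup>2 - 1)" by (simp add: power_mult_distrib right_diff_distrib)
    ultimately show ?thesis using x by (simp add: zero_less_mult_iff mult_ac split: split_indicator)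
  qed
  then have "(LBINT w. ?F (0 + x * w)) = (1 / x\<^sup>2) * pv_kernel (\<delta> / x) (x * t)"
    unfolding pv_kernel_def set_lebesgue_integral_def by (simp only: Bochner_Integration.integral_mult_right_zero)
  then show ?thesis
    unfolding set_lebesgue_integral_def
    using lborel_integral_real_affine[of x ?F 0] x by (simp add: power2_eq_square)
qed

definition remainder_kernel :: "real \<Rightarrow> real" where
  "remainder_kernel s = (if pi / 2 \<le> s then 1 else 0) - 2 / pi * rat_Si s"

lemma remainder_kernel_measurable [measurable]: "remainder_kernel \<in> borel_measurable borel"
  unfolding remainder_kernel_def[abs_def] by measurable

text \<open>The constant 6 comes from the range \<open>s < pi / 2\<close>: there the left side is at
  most \<open>2 / sqrt s\<close>, and \<open>1 + s \<le> 3\<close> because \<open>s \<le> 2\<close>.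
  In the other range the decay \<open>2 / s^2\<close> leaves room to spare.\<close>

lemma abs_remainder_kernel_le:
  assumes "s > 0"
  shows "\<bar>remainder_kernel s\<bar> / s \<le> 6 * (1 / (sqrt s * (1 + s)))"
proof -
  have sq: "sqrt s > 0" "sqrt s * sqrt s = s" using assms by auto
  show ?thesis
  proof (cases "pi / 2 \<le> s")
    case True
    then have "s \<ge> 1" using pi_gt3 by linarith
    have "remainder_kernel s = - (2 / pi * (rat_Si s - pi / 2))" using True by (simp add: remainder_kernel_def field_simps)
    then have "\<bar>remainder_kernel s\<bar> = \<bar>2 / pi\<bar> * \<bar>rat_Si s - pi / 2\<bar>" by (simp only: abs_minus_cancel abs_mult)
    also have "\<bar>2 / pi\<bar> = 2 / pi" by simp
    also have "2 / pi * \<bar>rat_Si s - pi / 2\<bar> \<le> 2 / pi * (2 / s)" using abs_rat_Si_diff_le[OF assms] by (intro mult_left_mono) auto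
    also have "\<dots> \<le> 1 * (2 / s)" using pi_gt3 assms by (intro mult_right_mono) auto
    finally have "\<bar>remainder_kernel s\<bar> / s \<le> 2 / s / s" using assms by (intro divide_right_mono) auto
    also have "\<dots> \<le> 6 * (1 / (sqrt s * (1 + s)))"
    proof -
      have "sqrt s \<le> s" by (rule real_le_lsqrt) (use \<open>s \<ge> 1\<close> in \<open>auto simp: power2_eq_square\<close>)
      then have "sqrt s * (1 + s) \<le> s * (2 * s)" using \<open>s \<ge> 1\<close> sq by (intro mult_mono) auto
      then have "2 * (sqrt s * (1 + s)) \<le> 6 * (s * s)" using zero_le_square[of s] by linarith
      moreover have "sqrt s * (1 + s) > 0" using sq assms by simp
      ultimately show ?thesis using assms by (simp add: divide_simps)
    qed
    finally show ?thesis .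
  next
    case False
    then have s2: "s \<le> 2" using pi_less_4 by linarith
    have "\<bar>remainder_kernel s\<bar> = 2 / pi * \<bar>rat_Si s\<bar>" using False by (simp add: remainder_kernel_def abs_mult)
    also have "\<dots> \<le> 2 / pi * (pi * sqrt s)" using abs_rat_Si_le_sqrt[of s] assms by (intro mult_left_mono) auto
    also have "\<dots> = 2 * sqrt s" by simp
    finally have "\<bar>remainder_kernel s\<bar> / s \<le> 2 * sqrt s / (sqrt s * sqrt s)" using assms sq by (simp add: divide_right_mono)
    also have "\<dots> = 2 / sqrt s"
      by (rule nonzero_mult_divide_mult_cancel_right) (use sq(1) in simp)
    also have "\<dots> \<le> 6 * (1 / (sqrt s * (1 + s)))" using sq(1) s2 assms by (simp add: divide_simps)
    finally show ?thesis .
  qed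
qed

lemma remainder_kernel_weight:
  shows "integrable lborel (\<lambda>s. indicator {0<..} s * (\<bar>remainder_kernel s\<bar> / s))"
    and "(LBINT s. indicator {0<..} s * (\<bar>remainder_kernel s\<bar> / s)) \<le> 6 * pi"
proof -
  have q: "integrable lborel (\<lambda>s. indicator {0<..} s * (6 * (1 / (sqrt s * (1 + s)))))"
    using set_integrable_mult_right[OF set_integrable_sqrt_weight, of 6] by (simp add: set_integrable_def)
  have le: "indicator {0<..} s * (\<bar>remainder_kernel s\<bar> / s) \<le> indicator {0<..} s * (6 * (1 / (sqrt s * (1 + s))))" for s
    using abs_remainder_kernel_le[of s] by (auto split: split_indicator)
  show int: "integrable lborel (\<lambda>s. indicator {0<..} s * (\<bar>remainder_kernel s\<bar> / s))"
  proof (rule Bochner_Integration.integrable_bound[OF q])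
    show "AE s in lborel. norm (indicator {0<..} s * (\<bar>remainder_kernel s\<bar> / s)) \<le> norm (indicator {0<..} s * (6 * (1 / (sqrt s * (1 + s)))))"
    proof (rule AE_I2)
      fix s
      have "0 \<le> indicator {0<..} s * (\<bar>remainder_kernel s\<bar> / s)" by (auto split: split_indicator)
      then show "norm (indicator {0<..} s * (\<bar>remainder_kernel s\<bar> / s)) \<le> norm (indicator {0<..} s * (6 * (1 / (sqrt s * (1 + s)))))"
        using le[of s] unfolding real_norm_def by linarith
    qed
  qed measurable
  have "(LBINT s. indicator {0<..} s * (\<bar>remainder_kernel s\<bar> / s)) \<le> (LBINT s. indicator {0<..} s * (6 * (1 / (sqrt s * (1 + s)))))"
    by (rule integral_mono[OF int q le])
  also have "\<dots> = (LBINT s:{0<..}. 6 * (1 / (sqrt s * (1 + s))))" by (simp add: set_lebesgue_integral_def)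
  also have "\<dots> = 6 * pi" by (subst set_integral_mult_right) (simp add: LBINT_sqrt_weight)
  finally show "(LBINT s. indicator {0<..} s * (\<bar>remainder_kernel s\<bar> / s)) \<le> 6 * pi" .
qed

text \<open>The measure \<open>dx / x\<close> is invariant under the scaling
  \<open>s = t * x\<close>. This is why the final constant depends neither on \<open>t\<close> nor
  on \<open>f\<close>.\<close>

lemma remainder_kernel_weight_scaled:
  assumes t: "t > 0"
  shows "integrable lborel (\<lambda>x. indicator {0<..} x * (\<bar>remainder_kernel (x * t)\<bar> / x))"
    and "(LBINT x. indicator {0<..} x * (\<bar>remainder_kernel (x * t)\<bar> / x)) = (LBINT s. indicator {0<..} s * (\<bar>remainder_kernel s\<bar> / s))"
proof -
  let ?F = "\<lambda>s. indicator {0<..} s * (\<bar>remainder_kernel s\<bar> / s)"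
  have eq: "indicator {0<..} x * (\<bar>remainder_kernel (x * t)\<bar> / x) = t * ?F (0 + t * x)" for x
    using t by (auto simp: zero_less_mult_iff mult.commute split: split_indicator)
  show "integrable lborel (\<lambda>x. indicator {0<..} x * (\<bar>remainder_kernel (x * t)\<bar> / x))"
    unfolding eq using t by (intro integrable_mult_right lborel_integrable_real_affine remainder_kernel_weight(1)) auto
  show "(LBINT x. indicator {0<..} x * (\<bar>remainder_kernel (x * t)\<bar> / x)) = (LBINT s. ?F s)"
  proof -
    have "(LBINT x. t * ?F (0 + t * x)) = t * (LBINT x. ?F (0 + t * x))"
      by (rule Bochner_Integration.integral_mult_right_zero)
    also have "\<dots> = \<bar>t\<bar> *\<^sub>R (LBINT x. ?F (0 + t * x))" using t by (simp only: real_scaleR_def abs_of_pos)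
    also have "\<dots> = (LBINT s. ?F s)"
      by (rule lborel_integral_real_affine[symmetric]) (use t in simp)
    finally show ?thesis unfolding eq .
  qed
qed

context half_line_primitive
begin

text \<open>The factor \<open>u\<close> in \<open>H0_kernel\<close> cancels the division by
  \<open>u\<close> in \<open>T_op\<close>, leaving the sine transform of \<open>g\<close> against
  \<open>1 / (u^2 - x^2)\<close>. Off the window this kernel is integrable, so Fubini applies for
  each fixed \<open>\<delta>\<close>.\<close>

lemma H0_truncated_eq:
  assumes x: "x > 0" and \<delta>: "\<delta> > 0"
  shows "H0_kernel (T_op (ae_deriv f)) x absolutely_integrable_on {t. 0 < t \<and> \<delta> < \<bar>t - x\<bar>}"
    and "H0_truncated (T_op (ae_deriv f)) x \<delta> =
      of_real (2 / pi) * (LBINT t. (1 / x * pv_kernel (\<delta> / x) (x * t)) *\<^sub>R g t)"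
proof -
  let ?S = "{u. 0 < u \<and> \<delta> < \<bar>u - x\<bar>}"
  define p where "p u = indicator ?S u * (1 / (u\<^sup>2 - x\<^sup>2))" for u
  have "set_integrable lborel ?S (\<lambda>u. 1 / (u\<^sup>2 - x\<^sup>2))"
    by (rule set_integrable_subset[OF set_integrable_inverse_diff_squares[OF x \<delta>]]) auto
  then have p: "integrable lborel p" by (simp add: set_integrable_def p_def[abs_def])
  have K: "(\<lambda>(u, t). sin (u * t) :: real) \<in> borel_measurable (lborel \<Otimes>\<^sub>M lborel)"
    unfolding split_beta' by measurable
  note F = Fubini_bounded_kernel[OF p g_integrable K abs_sin_le_one]
  let ?\<psi> = "\<lambda>u. (1 / (u\<^sup>2 - x\<^sup>2)) *\<^sub>R (LBINT t. sin (u * t) *\<^sub>R g t)"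
  have \<psi>: "set_integrable lborel ?S ?\<psi>"
    using F(2) by (simp add: set_integrable_def p_def)
  have eq: "H0_kernel (T_op (ae_deriv f)) x u = ?\<psi> u" if "u \<in> ?S - {}" for u
    using that by (simp add: H0_kernel_def T_op_def sine_transform_ae_deriv scaleR_conv_of_real)
  show "H0_kernel (T_op (ae_deriv f)) x absolutely_integrable_on ?S"
    by (rule set_integral_lebesgue_eq_lborel(1)[OF \<psi> negligible_empty eq])
  have "(LINT u:?S|lebesgue. H0_kernel (T_op (ae_deriv f)) x u) = (LBINT u:?S. ?\<psi> u)"
    by (rule set_integral_lebesgue_eq_lborel(2)[OF \<psi> negligible_empty eq])
  also have "\<dots> = (LBINT u. p u *\<^sub>R (LBINT t. sin (u * t) *\<^sub>R g t))"
    by (simp add: set_lebesgue_integral_def p_def)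
  also have "\<dots> = (LBINT t. (LBINT u. p u * sin (u * t)) *\<^sub>R g t)" by (rule F(1))
  also have "(\<lambda>t. LBINT u. p u * sin (u * t)) = (\<lambda>t. 1 / x * pv_kernel (\<delta> / x) (x * t))"
    using LBINT_sin_kernel_scaled[OF x, of \<delta>] by (simp add: set_lebesgue_integral_def p_def)
  finally show "H0_truncated (T_op (ae_deriv f)) x \<delta> =
      of_real (2 / pi) * (LBINT t. (1 / x * pv_kernel (\<delta> / x) (x * t)) *\<^sub>R g t)"
    unfolding H0_truncated_def by simp
qed

lemma H0_T_ae_deriv:
  assumes x: "x > 0"
  shows "H0_exists (T_op (ae_deriv f)) x"
    and "H0 (T_op (ae_deriv f)) x =
      of_real (2 / pi) * (LBINT t. (1 / x * (rat_Si (x * t) + pi / 2 * (cos (x * t) - 1))) *\<^sub>R g t)"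
proof -
  obtain B where B: "\<And>s \<delta>. \<lbrakk>s > 0; 0 < \<delta>; \<delta> \<le> 1 / 2\<rbrakk> \<Longrightarrow> \<bar>pv_kernel \<delta> s\<bar> \<le> B"
    using bounded_pv_kernel by blast
  let ?L = "LBINT t. (1 / x * (rat_Si (x * t) + pi / 2 * (cos (x * t) - 1))) *\<^sub>R g t"
  \<comment> \<open>Writing \<open>\<delta>\<close> as \<open>inverse A\<close> turns the limit at 0
    into one at infinity, the form in which dominated convergence is applied.\<close>
  have "((\<lambda>A. LBINT t. (1 / x * pv_kernel (inverse A / x) (x * t)) *\<^sub>R g t) \<longlongrightarrow> ?L) at_top"
  proof (rule integral_dominated_convergence_at_top[where w = "\<lambda>t. 1 / x * B * norm (g t)"])
    show "integrable lborel (\<lambda>t. 1 / x * B * norm (g t))"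
      by (intro integrable_mult_right integrable_norm g_integrable)
    show "\<forall>\<^sub>F A in at_top. AE t in lborel. norm ((1 / x * pv_kernel (inverse A / x) (x * t)) *\<^sub>R g t) \<le> 1 / x * B * norm (g t)"
      \<comment> \<open>\<open>A \<ge> 2 / x\<close> means \<open>inverse A / x \<le> 1 / 2\<close>,
        the range in which the uniform kernel bound holds.\<close>
      using eventually_ge_at_top[of "2 / x"] eventually_gt_at_top[of 0]
    proof eventually_elim
      case (elim A)
      then have "inverse A / x \<le> 1 / 2" using x by (simp add: field_simps)
      show ?case
      proof (rule AE_I2)
        fix t
        show "norm ((1 / x * pv_kernel (inverse A / x) (x * t)) *\<^sub>R g t) \<le> 1 / x * B * norm (g t)"
        proof (cases "t > 0")
          case True
          then have "\<bar>pv_kernel (inverse A / x) (x * t)\<bar> \<le> B"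
            using B[of "x * t" "inverse A / x"] elim x \<open>inverse A / x \<le> 1 / 2\<close> by simp
          then have "1 / x * \<bar>pv_kernel (inverse A / x) (x * t)\<bar> * norm (g t) \<le> 1 / x * B * norm (g t)"
            using x by (intro mult_right_mono mult_left_mono) auto
          then show ?thesis using x by (simp add: abs_mult)
        qed (simp add: g_zero)
      qed
    qed
    show "AE t in lborel. ((\<lambda>A. (1 / x * pv_kernel (inverse A / x) (x * t)) *\<^sub>R g t) \<longlongrightarrow>
        (1 / x * (rat_Si (x * t) + pi / 2 * (cos (x * t) - 1))) *\<^sub>R g t) at_top"
    proof (rule AE_I2)
      fix t
      show "((\<lambda>A. (1 / x * pv_kernel (inverse A / x) (x * t)) *\<^sub>R g t) \<longlongrightarrow>
          (1 / x * (rat_Si (x * t) + pi / 2 * (cos (x * t) - 1))) *\<^sub>R g t) at_top"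
      proof (cases "t > 0")
        case True
        have to0: "filterlim (\<lambda>A. inverse A / x) (at_right 0) at_top"
        proof (rule tendsto_imp_filterlim_at_right)
          show "((\<lambda>A. inverse A / x) \<longlongrightarrow> 0) at_top"
            using tendsto_divide[OF tendsto_inverse_0_at_top[OF filterlim_ident] tendsto_const, of x] x by simp
          show "\<forall>\<^sub>F A in at_top. 0 < inverse A / x"
            using eventually_gt_at_top[of 0] by eventually_elim (use x in auto)
        qed
        have "((\<lambda>A. pv_kernel (inverse A / x) (x * t)) \<longlongrightarrow> rat_Si (x * t) + pi / 2 * (cos (x * t) - 1)) at_top"
          by (rule filterlim_compose[OF tendsto_pv_kernel to0]) (use True x in simp)
        then show ?thesis by (intro tendsto_scaleR tendsto_mult tendsto_const)
      qed (simp add: g_zero)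
    qed
  qed measurable
  then have "((\<lambda>\<delta>. LBINT t. (1 / x * pv_kernel (\<delta> / x) (x * t)) *\<^sub>R g t) \<longlongrightarrow> ?L) (at_right 0)"
    unfolding filterlim_at_right_to_top by simp
  then have "((\<lambda>\<delta>. of_real (2 / pi) * (LBINT t. (1 / x * pv_kernel (\<delta> / x) (x * t)) *\<^sub>R g t)) \<longlongrightarrow> of_real (2 / pi) * ?L) (at_right 0)"
    by (intro tendsto_mult tendsto_const)
  then have lim: "(H0_truncated (T_op (ae_deriv f)) x \<longlongrightarrow> of_real (2 / pi) * ?L) (at_right 0)"
  proof (rule tendsto_cong[THEN iffD1, rotated])
    show "\<forall>\<^sub>F \<delta> in at_right 0. of_real (2 / pi) * (LBINT t. (1 / x * pv_kernel (\<delta> / x) (x * t)) *\<^sub>R g t) =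
        H0_truncated (T_op (ae_deriv f)) x \<delta>"
      using eventually_at_right_less[of 0] by eventually_elim (use H0_truncated_eq(2)[OF x] in auto)
  qed
  then show "H0_exists (T_op (ae_deriv f)) x"
    unfolding H0_exists_def using H0_truncated_eq(1)[OF x] by blast
  show "H0 (T_op (ae_deriv f)) x = of_real (2 / pi) * ?L"
    unfolding H0_def using lim by (intro tendsto_Lim) auto
qed

text \<open>The indicator makes the value 0 for nonpositive \<open>x\<close>, so that Fubini can be
  applied on the whole plane.\<close>

definition remainder :: "real \<Rightarrow> complex" where
  "remainder x = (LBINT t. (indicator {0<..} x * (remainder_kernel (x * t) / x)) *\<^sub>R g t)"

text \<open>With the \<open>x\<close>-integration performed first, the inner integral is the same
  multiple of \<open>norm (g t)\<close> for every \<open>t\<close>, by the scaling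
  invariance.\<close>

lemma remainder_bound:
  shows "integrable lborel remainder" and "(LBINT x. norm (remainder x)) \<le> 6 * pi * (LBINT t. norm (g t))"
proof -
  let ?H = "\<lambda>t x. (indicator {0<..} x * (remainder_kernel (x * t) / x)) *\<^sub>R g t"
  let ?M = "LBINT s. indicator {0<..} s * (\<bar>remainder_kernel s\<bar> / s)"
  have norm_H: "norm (?H t x) = (indicator {0<..} x * (\<bar>remainder_kernel (x * t)\<bar> / x)) * norm (g t)" for t x
    by (auto simp: abs_mult split: split_indicator)
  have inner: "(LBINT x. norm (?H t x)) = ?M * norm (g t)" for t
    unfolding norm_H Bochner_Integration.integral_mult_left_zero
    using remainder_kernel_weight_scaled(2)[of t] by (cases "t > 0") (simp_all only: g_zero not_less norm_zero mult_zero_right)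
  have int: "integrable (lborel \<Otimes>\<^sub>M lborel) (\<lambda>(t, x). ?H t x)"
  proof (rule lborel_pair.Fubini_integrable)
    show "integrable lborel (\<lambda>t. LBINT x. norm (case (t, x) of (t, x) \<Rightarrow> ?H t x))"
      unfolding prod.case inner by (intro integrable_mult_right integrable_norm g_integrable)
    show "AE t in lborel. integrable lborel (\<lambda>x. case (t, x) of (t, x) \<Rightarrow> ?H t x)"
    proof (rule AE_I2)
      fix t
      have "integrable lborel (\<lambda>x. norm (?H t x))"
      proof (cases "t > 0")
        case True
        then show ?thesis
          unfolding norm_H by (intro integrable_mult_left remainder_kernel_weight_scaled(1))
      qed (simp add: g_zero)
      then show "integrable lborel (\<lambda>x. case (t, x) of (t, x) \<Rightarrow> ?H t x)"
        by (subst (asm) integrable_norm_iff) auto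
    qed
  qed measurable
  show "integrable lborel remainder"
    using lborel_pair.integrable_snd[OF int] by (simp add: remainder_def[abs_def])
  have intn: "integrable (lborel \<Otimes>\<^sub>M lborel) (\<lambda>(t, x). norm (?H t x))"
    using integrable_norm[OF int] by (simp add: split_beta')
  have "(LBINT x. norm (remainder x)) \<le> (LBINT x. LBINT t. norm (?H t x))"
    unfolding remainder_def
  proof (rule integral_mono_AE)
    show "integrable lborel (\<lambda>x. norm (LBINT t. ?H t x))"
      by (rule integrable_norm[OF lborel_pair.integrable_snd[OF int]])
    show "integrable lborel (\<lambda>x. LBINT t. norm (?H t x))"
      by (rule lborel_pair.integrable_snd[OF intn])
    show "AE x in lborel. norm (LBINT t. ?H t x) \<le> (LBINT t. norm (?H t x))"
      by (intro AE_I2 integral_norm_bound)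
  qed
  also have "\<dots> = (LBINT t. LBINT x. norm (?H t x))" by (rule lborel_pair.Fubini_integral[OF intn])
  also have "\<dots> = ?M * (LBINT t. norm (g t))" unfolding inner by simp
  also have "\<dots> \<le> 6 * pi * (LBINT t. norm (g t))"
    using remainder_kernel_weight(2) by (intro mult_right_mono) auto
  finally show "(LBINT x. norm (remainder x)) \<le> 6 * pi * (LBINT t. norm (g t))" .
qed

text \<open>The factor \<open>2 / pi\<close> cancels the \<open>pi / 2\<close> in front of the
  cosine, so this part of the Hilbert transform is exactly the sine transform of \<open>f\<close>.
  The two parts of \<open>remainder\<close> cancel the value of \<open>f\<close> and the
  \<open>rat_Si\<close> term.\<close>

lemma sine_transform_decomposition:
  assumes x: "x > 0"
  shows "sine_transform f x = of_real (1 / x) * f (pi / (2 * x)) + H0 (T_op (ae_deriv f)) x + remainder x"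
proof -
  obtain B where B: "\<And>s. s > 0 \<Longrightarrow> \<bar>rat_Si s\<bar> \<le> B" using bounded_rat_Si by blast
  let ?step = "\<lambda>t. if pi / 2 \<le> x * t then 1 else 0 :: real"
  have iJ: "integrable lborel (\<lambda>t. rat_Si (x * t) *\<^sub>R g t)"
    by (rule g_mult_integrable[of _ B]) (use B x in auto)
  have ic: "integrable lborel (\<lambda>t. (cos (x * t) - 1) *\<^sub>R g t)"
  proof (rule g_mult_integrable[of _ 2])
    show "\<bar>cos (x * t) - 1\<bar> \<le> 2" for t using abs_cos_le_one[of "x * t"] by linarith
  qed measurable
  have ist: "integrable lborel (\<lambda>t. ?step t *\<^sub>R g t)"
    by (rule g_mult_integrable[of _ 1]) auto
  have S: "sine_transform f x = (1 / x) *\<^sub>R (LBINT t. (cos (x * t) - 1) *\<^sub>R g t)"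
    unfolding sine_transform_f(2)[OF x] by (simp flip: integral_scaleR_right)
  have "f (pi / (2 * x)) = - (LBINT t. ?step t *\<^sub>R g t)"
  proof -
    have "(LBINT t:{pi / (2 * x)..}. g t) = (LBINT t. ?step t *\<^sub>R g t)"
      unfolding set_lebesgue_integral_def
      by (rule Bochner_Integration.integral_cong) (use x in \<open>auto simp: field_simps split: split_indicator\<close>)
    then show ?thesis using f_eq_tail[of "pi / (2 * x)"] x by simp
  qed
  then have F: "of_real (1 / x) * f (pi / (2 * x)) = - ((1 / x) *\<^sub>R (LBINT t. ?step t *\<^sub>R g t))"
    by (simp add: scaleR_conv_of_real)
  have "(LBINT t. (1 / x * (rat_Si (x * t) + pi / 2 * (cos (x * t) - 1))) *\<^sub>R g t) =
      (LBINT t. (1 / x) *\<^sub>R (rat_Si (x * t) *\<^sub>R g t) + (pi / (2 * x)) *\<^sub>R ((cos (x * t) - 1) *\<^sub>R g t))"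
    by (rule Bochner_Integration.integral_cong) (auto simp: algebra_simps add_divide_distrib diff_divide_distrib)
  also have "\<dots> = (1 / x) *\<^sub>R (LBINT t. rat_Si (x * t) *\<^sub>R g t) + (pi / (2 * x)) *\<^sub>R (LBINT t. (cos (x * t) - 1) *\<^sub>R g t)"
    by (simp only: integral_scaleR_right
        Bochner_Integration.integral_add[OF integrable_scaleR_right[OF iJ] integrable_scaleR_right[OF ic]])
  finally have "H0 (T_op (ae_deriv f)) x = (2 / pi) *\<^sub>R ((1 / x) *\<^sub>R (LBINT t. rat_Si (x * t) *\<^sub>R g t) +
      (pi / (2 * x)) *\<^sub>R (LBINT t. (cos (x * t) - 1) *\<^sub>R g t))"
    unfolding H0_T_ae_deriv(2)[OF x] by (simp only: scaleR_conv_of_real)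
  also have "\<dots> = (1 / x) *\<^sub>R ((2 / pi) *\<^sub>R (LBINT t. rat_Si (x * t) *\<^sub>R g t)) + (1 / x) *\<^sub>R (LBINT t. (cos (x * t) - 1) *\<^sub>R g t)"
    by (simp add: scaleR_add_right)
  finally have H: "H0 (T_op (ae_deriv f)) x = (1 / x) *\<^sub>R ((2 / pi) *\<^sub>R (LBINT t. rat_Si (x * t) *\<^sub>R g t)) +
      (1 / x) *\<^sub>R (LBINT t. (cos (x * t) - 1) *\<^sub>R g t)" .
  have "remainder x = (LBINT t. (1 / x) *\<^sub>R (?step t *\<^sub>R g t - (2 / pi) *\<^sub>R (rat_Si (x * t) *\<^sub>R g t)))"
    unfolding remainder_def remainder_kernel_def using x
    by (intro Bochner_Integration.integral_cong) (auto simp: diff_divide_distrib scaleR_diff_left scaleR_diff_right)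
  also have "\<dots> = (1 / x) *\<^sub>R ((LBINT t. ?step t *\<^sub>R g t) - (2 / pi) *\<^sub>R (LBINT t. rat_Si (x * t) *\<^sub>R g t))"
    by (simp only: integral_scaleR_right
        Bochner_Integration.integral_diff[OF ist integrable_scaleR_right[OF iJ]])
  finally have GG: "remainder x = (1 / x) *\<^sub>R (LBINT t. ?step t *\<^sub>R g t) - (1 / x) *\<^sub>R ((2 / pi) *\<^sub>R (LBINT t. rat_Si (x * t) *\<^sub>R g t))"
    by (simp only: scaleR_diff_right)
  show ?thesis unfolding S F H GG by simp
qed

lemma remainder_L1:
  shows "remainder absolutely_integrable_on {0..}" and "L1_norm remainder \<le> 6 * pi * L1_norm (ae_deriv f)"
proof -
  have G: "set_integrable lborel {0..} remainder"
    unfolding set_integrable_def using remainder_bound(1) by (intro integrable_mult_indicator) auto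
  show "remainder absolutely_integrable_on {0..}"
    by (rule set_integral_lebesgue_eq_lborel(1)[OF G negligible_empty refl])
  have "L1_norm remainder = (LBINT x:{0..}. norm (remainder x))"
    unfolding L1_norm_def
    by (rule set_integral_lebesgue_eq_lborel(2)[OF set_integrable_norm[OF G] negligible_empty refl])
  also have "\<dots> = (LBINT x. norm (remainder x))"
    unfolding set_lebesgue_integral_def
    by (rule Bochner_Integration.integral_cong) (auto simp: remainder_def split: split_indicator)
  finally show "L1_norm remainder \<le> 6 * pi * L1_norm (ae_deriv f)"
    using remainder_bound(2) unfolding L1_norm_ae_deriv by simp
qed

end

theorem theorem3:
  shows "\<exists>C::real. C > 0 \<and>
    (\<forall>f :: real \<Rightarrow> complex.
       locally_abs_continuous_on f {0..} \<and> bounded_variation_on f {0..} \<and> (f \<longlongrightarrow> 0) at_top \<longrightarrow>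
       ae_deriv f absolutely_integrable_on {0..} \<and>
       (\<exists>G :: real \<Rightarrow> complex.
          (\<forall>x>0. sine_transform_exists f x \<and> H0_exists (T_op (ae_deriv f)) x \<and>
             sine_transform f x =
               of_real (1 / x) * f (pi / (2 * x)) + H0 (T_op (ae_deriv f)) x + G x) \<and>
          G absolutely_integrable_on {0..} \<and>
          L1_norm G \<le> C * L1_norm (ae_deriv f)))"
proof (intro exI[of _ "6 * pi"] conjI allI impI)
  fix f :: "real \<Rightarrow> complex"
  assume "locally_abs_continuous_on f {0..} \<and> bounded_variation_on f {0..} \<and> (f \<longlongrightarrow> 0) at_top"
  then have ac: "locally_abs_continuous_on f {0..}" and bv: "bounded_variation_on f {0..}"
    and lim: "(f \<longlongrightarrow> 0) at_top" by auto
  obtain g where "integrable lborel g" "\<And>x. x \<le> 0 \<Longrightarrow> g x = 0"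
    "\<And>a b. \<lbrakk>0 \<le> a; a \<le> b\<rbrakk> \<Longrightarrow> f b - f a = (LINT x:{a..b}|lborel. g x)"
    by (rule complex_abs_continuous_density[OF ac bv]) (rule that)
  with lim interpret half_line_primitive f g by unfold_locales auto
  show "ae_deriv f absolutely_integrable_on {0..}" by (rule ae_deriv_absolutely_integrable)
  show "\<exists>G :: real \<Rightarrow> complex.
          (\<forall>x>0. sine_transform_exists f x \<and> H0_exists (T_op (ae_deriv f)) x \<and>
             sine_transform f x =
               of_real (1 / x) * f (pi / (2 * x)) + H0 (T_op (ae_deriv f)) x + G x) \<and>
          G absolutely_integrable_on {0..} \<and>
          L1_norm G \<le> 6 * pi * L1_norm (ae_deriv f)"
    using sine_transform_f(1) H0_T_ae_deriv(1) sine_transform_decomposition remainder_L1 by blast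
qed simp

end
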